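(* Let $E$ be a real uniformly smooth and 2-uniformly convex Banach space with dual $E^*$, and let $C$ be a nonempty closed convex subset of $E$. Let $A_1,\dots,A_M : C\to E^*$ be mappings and $\alpha>0$ a constant such that for each $i$: (V1) $A_i$ is $\alpha$-inverse strongly monotone; (V2) $VI(A_i,C)\neq\emptyset$; (V3) $\|A_iy\|\le\|A_iy-A_iu\|$ for all $y\in C$ and $u\in VI(A_i,C)$. Let $f_1,\dots,f_K: C\times C\to\mathbb{R}$ be bifunctions such that for each $k$: (A1) $f_k(x,x)=0$ for all $x\in C$; (A2) $f_k(x,y)+f_k(y,x)\le 0$ for all $x,y\in C$; (A3) $\limsup_{t\to0^+}f_k(tz+(1-t)x,y)\le f_k(x,y)$ for all $x,y,z\in C$; (A4) for each $x\in C$, $f_k(x,\cdot)$ is convex and lower semicontinuous. Let $S_1,\dots,S_N: C\to C$ be uniformly $L$-Lipschitz continuous (for a common $L>0$) and quasi $\phi$-asymptotically nonexpansive with the same sequence $\{k_n\}\subset[1,+\infty)$, $k_n\to1$. Put $$F=\Big(\bigcap_{i=1}^M VI(A_i,C)\Big)\cap\Big(\bigcap_{j=1}^N F(S_j)\Big)\cap\Big(\bigcap_{k=1}^K EP(f_k)\Big).$$ Assume $F\ne\emptyset$ and that there is $\omega>0$ with $F\subset\{u\in C:\|u\|\le\omega\}$. Let $\{\alpha_{n,j}\}$ ($0\le j\le N$), $\{\lambda_n\},\{r_n\}$ be real sequences with $$0\le\alpha_{n,j}\le1,\quad \sum_{j=0}^N\alpha_{n,j}=1,\quad \liminf_{n\to\infty}\alpha_{n,0}\alpha_{n,j}>0\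 (j=1,\dots,N),\quad \lambda_n\in[a,b],\quad r_n\ge d$$ for some $a,b\in(0,\alpha c^2/2)$ and $d>0$, where $1/c$ is the 2-uniform convexity constant of $E$. Let $x_0\in C$ be arbitrary, $C_0=C$, and for $n\ge0$ define $$\begin{aligned} &y_n^i=\Pi_C\big(J^{-1}(Jx_n-\lambda_nA_ix_n)\big),\quad i=1,\dots,M,\\ &i_n\in\arg\max\{\|y_n^i-x_n\|:1\le i\le M\},\quad \bar y_n=y_n^{i_n},\\ &z_n=J^{-1}\Big(\alpha_{n,0}Jx_n+\sum_{j=1}^N\alpha_{n,j}JS_j^n\bar y_n\Big),\\ &u_n^k=T_{r_n}^kz_n,\quad k=1,\dots,K,\\ &\ell_n\in\arg\max\{\|u_n^k-x_n\|:1\le k\le K\},\quad \bar u_n=u_n^{\ell_n},\\ &C_{n+1}=\{z\in C_n:\phi(z,\bar u_n)\le\phi(z,x_n)+\epsilon_n\},\\ &x_{n+1}=\Pi_{C_{n+1}}x_0, \end{aligned}$$ where $\epsilon_n=(k_n-1)(\omega+\|x_n\|)^2$. Then $\{x_n\}$ converges strongly to $\Pi_Fx_0$.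
   Context: $J:E\to E^*$ is the normalized duality mapping, $\langle Jx,x\rangle=\|x\|^2=\|Jx\|^2$ (single-valued and bijective here). The 2-uniform convexity constant $1/c$ of $E$: $c$ is the best (largest) constant in $(0,1]$ such that $\|x-y\|\le\frac{2}{c^2}\|Jx-Jy\|$ for all $x,y\in E$. Lyapunov functional: $\phi(x,y)=\|x\|^2-2\langle x,Jy\rangle+\|y\|^2$ for $x,y\in E$. For a nonempty closed convex $D\subset E$, the generalized projection $\Pi_D:E\to D$ is $\Pi_D(x)=\arg\min_{y\in D}\phi(y,x)$ (the unique minimizer). For $A:C\to E^*$: $A$ is $\alpha$-inverse strongly monotone if $\langle Ax-Ay,x-y\rangle\ge\alpha\|Ax-Ay\|^2$ for all $x,y\in C$; $VI(A,C)=\{p^*\in C:\langle Ap^*,p-p^*\rangle\ge0\ \forall p\in C\}$. For $f:C\times C\to\mathbb{R}$: $EP(f)=\{\hat x\in C: f(\hat x,y)\ge0\ \forall y\in C\}$. For $r>0$ and $x\in E$, $T_r^kx$ denotes the unique $z\in C$ with $f_k(z,y)+\frac1r\langle y-z,Jz-Jx\rangle\ge0$ for all $y\in C$ (existence and uniqueness hold under (A1)-(A4)). For $T:C\to C$: $F(T)$ is the fixed point set. $T$ is uniformly $L$-Lipschitz continuous if $\|T^nx-T^ny\|\le L\|x-y\|$ for all $n\ge1$, $x,y\in C$. $T$ is quasi $\phi$-asymptotically nonexpansive with sequence $\{k_n\}\subset[1,\infty)$, $k_n\to1$, if $F(T)\neq\emptyset$ and $\phi(p,T^nx)\le k_n\phi(p,x)$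 for all $n\ge1$, $p\in F(T)$, $x\in C$. Convention: $S_j^0$ is the identity and $k_0\in[1,\infty)$ is any number. Ties in the $\arg\max$ are broken arbitrarily. *)

theory Defs
  imports "HOL-Analysis.Analysis"
begin

text \<open>
  The ambient space \<open>E\<close> is a type of class \<open>banach\<close>; its dual is \<open>'a \<Rightarrow>\<^sub>L real\<close> with the operator
  norm, and the pairing \<open>\<langle>f, x\<rangle>\<close> is \<open>blinfun_apply f x\<close>. Maps on a subset \<open>C\<close> are total functions
  of which only the values on \<open>C\<close> matter.
\<close>

text \<open>
  Uniform smoothness: the limit of \<open>(norm (x + t y) - norm x) / t\<close> as \<open>t \<rightarrow> 0\<close> exists uniformly in
  \<open>x, y\<close> on the unit sphere.
\<close>

definition uniformly_smooth :: "'a::real_normed_vector itself \<Rightarrow> bool" where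
  "uniformly_smooth (_ :: 'a itself) \<longleftrightarrow>
     (\<exists>D :: 'a \<times> 'a \<Rightarrow> real.
        uniform_limit (sphere 0 1 \<times> sphere 0 1)
          (\<lambda>t (x, y). (norm (x + t *\<^sub>R y) - norm x) / t) D (at 0))"

text \<open>
  The modulus is an infimum in \<open>[0, 1]\<close>, so it is \<open>1\<close> when no pair qualifies; inserting \<open>1\<close>
  expresses this and does not affect the infimum otherwise.
\<close>

definition modulus_of_convexity :: "'a::real_normed_vector itself \<Rightarrow> real \<Rightarrow> real" where
  "modulus_of_convexity (_ :: 'a itself) \<epsilon> =
     Inf (insert 1 {1 - norm ((x + y) /\<^sub>R 2) | x y :: 'a.
            norm x = 1 \<and> norm y = 1 \<and> \<epsilon> \<le> norm (x - y)})"

definition two_uniformly_convex :: "'a::real_normed_vector itself \<Rightarrow> bool" where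
  "two_uniformly_convex (_ :: 'a itself) \<longleftrightarrow>
     (\<exists>\<kappa>>0. \<forall>\<epsilon>\<in>{0<..2}. \<kappa> * \<epsilon>\<^sup>2 \<le> modulus_of_convexity TYPE('a) \<epsilon>)"

definition duality_map :: "'a::real_normed_vector \<Rightarrow> ('a \<Rightarrow>\<^sub>L real)" where
  "duality_map x = (THE f. blinfun_apply f x = (norm x)\<^sup>2 \<and> (norm x)\<^sup>2 = (norm f)\<^sup>2)"

abbreviation duality_map_inv :: "('a::real_normed_vector \<Rightarrow>\<^sub>L real) \<Rightarrow> 'a" where
  "duality_map_inv \<equiv> inv duality_map"

text \<open>
  This is the number \<open>c\<close>; the 2-uniform convexity constant in the literature is \<open>1 / c\<close>.
\<close>

definition uniform_convexity_c :: "'a::real_normed_vector itself \<Rightarrow> real" where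
  "uniform_convexity_c (_ :: 'a itself) =
     (GREATEST c. 0 < c \<and> c \<le> 1 \<and>
        (\<forall>x y :: 'a. norm (x - y) \<le> 2 / c\<^sup>2 * norm (duality_map x - duality_map y)))"

definition lyapunov :: "'a::real_normed_vector \<Rightarrow> 'a \<Rightarrow> real" where
  "lyapunov x y = (norm x)\<^sup>2 - 2 * blinfun_apply (duality_map y) x + (norm y)\<^sup>2"

definition generalized_projection :: "'a::real_normed_vector set \<Rightarrow> 'a \<Rightarrow> 'a" where
  "generalized_projection D x = arg_min_on (\<lambda>y. lyapunov y x) D"

definition inverse_strongly_monotone_on ::
    "real \<Rightarrow> 'a::real_normed_vector set \<Rightarrow> ('a \<Rightarrow> ('a \<Rightarrow>\<^sub>L real)) \<Rightarrow> bool" where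
  "inverse_strongly_monotone_on \<alpha> C A \<longleftrightarrow>
     (\<forall>x\<in>C. \<forall>y\<in>C. blinfun_apply (A x - A y) (x - y) \<ge> \<alpha> * (norm (A x - A y))\<^sup>2)"

definition VI :: "('a::real_normed_vector \<Rightarrow> ('a \<Rightarrow>\<^sub>L real)) \<Rightarrow> 'a set \<Rightarrow> 'a set" where
  "VI A C = {p\<in>C. \<forall>q\<in>C. blinfun_apply (A p) (q - p) \<ge> 0}"

definition lower_semicontinuous_on :: "'a::topological_space set \<Rightarrow> ('a \<Rightarrow> real) \<Rightarrow> bool" where
  "lower_semicontinuous_on S g \<longleftrightarrow>
     (\<forall>x\<in>S. ereal (g x) \<le> Liminf (at x within S) (\<lambda>y. ereal (g y)))"

definition EP :: "('a \<Rightarrow> 'a \<Rightarrow> real) \<Rightarrow> 'a set \<Rightarrow> 'a set" where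
  "EP f C = {x\<in>C. \<forall>y\<in>C. f x y \<ge> 0}"

definition resolvent ::
    "('a \<Rightarrow> 'a \<Rightarrow> real) \<Rightarrow> 'a::real_normed_vector set \<Rightarrow> real \<Rightarrow> 'a \<Rightarrow> 'a" where
  "resolvent f C r x =
     (THE z. z \<in> C \<and>
        (\<forall>y\<in>C. f z y + 1 / r * blinfun_apply (duality_map z - duality_map x) (y - z) \<ge> 0))"

definition fixed_points :: "('a \<Rightarrow> 'a) \<Rightarrow> 'a set \<Rightarrow> 'a set" where
  "fixed_points T C = {x\<in>C. T x = x}"

definition uniformly_lipschitz_on :: "real \<Rightarrow> 'a::metric_space set \<Rightarrow> ('a \<Rightarrow> 'a) \<Rightarrow> bool" where
  "uniformly_lipschitz_on L C T \<longleftrightarrow> (\<forall>n\<ge>1. L-lipschitz_on C (T ^^ n))"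

text \<open>
  The estimate concerns only \<open>n \<ge> 1\<close>; \<open>k 0\<close> is an arbitrary number in \<open>[1, \<infinity>)\<close>.
\<close>

definition quasi_phi_asymptotically_nonexpansive_on ::
    "(nat \<Rightarrow> real) \<Rightarrow> 'a::real_normed_vector set \<Rightarrow> ('a \<Rightarrow> 'a) \<Rightarrow> bool" where
  "quasi_phi_asymptotically_nonexpansive_on k C T \<longleftrightarrow>
     (\<forall>n. 1 \<le> k n) \<and> k \<longlonglongrightarrow> 1 \<and> fixed_points T C \<noteq> {} \<and>
     (\<forall>n\<ge>1. \<forall>p\<in>fixed_points T C. \<forall>x\<in>C. lyapunov p ((T ^^ n) x) \<le> k n * lyapunov p x)"

end

theory Submission
  imports Defs
begin

text \<open>
  Testing the definition of the sets \<open>C\<^sub>n\<close> with points of \<open>F\<close> shows \<open>F \<subseteq> C\<^sub>n\<close>, so \<open>\<phi>(x\<^sub>n, x\<^sub>0)\<close> is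
  increasing and bounded; as \<open>\<phi>(x, y)\<close> dominates a multiple of \<open>\<parallel>x - y\<parallel>\<^sup>2\<close>, the iterates converge
  to the minimizer of \<open>\<phi>(\<cdot>, x\<^sub>0)\<close> over all \<open>C\<^sub>n\<close>. The slack in the estimate for \<open>F \<subseteq> C\<^sub>n\<close> controls
  \<open>\<parallel>A x\<^sub>n\<parallel>\<close> and the distances between \<open>x\<^sub>n\<close>, \<open>z\<^sub>n\<close> and \<open>S\<^sub>j\<^sup>n y\<^sub>n\<close>, so the limit lies in \<open>F\<close>.

  All the functional analysis is obtained from the norm itself. The duality map is the derivative of
  the norm, surjective because \<open>\<parallel>x\<parallel>\<^sup>2 - 2 f(x)\<close> has a minimizer. Resolvents exist by Minty's reformulation:
  a finite subfamily of the Minty inequalities is a matrix game with nonpositive symmetric part, and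
  bounded closed convex sets with the finite intersection property have a common point.
\<close>

section \<open>The duality map of a uniformly smooth space\<close>

text \<open>The order of the argument matters: the nested minimization alone makes \<open>x\<close>
  converge, only then is \<epsilon> n known to vanish, and only then does the slack tend to 0. The
  slack has two sources. The projected dual step lowers \<open>lyapunov p\<close> by at least
  \<open>2 * lam n * (\<alpha> - lam n * 2 / c\<^sup>2)\<close> times the squared norm of
  \<open>A x\<close>, a coefficient that is positive exactly for \<open>lam n\<close> below
  \<open>\<alpha> * c\<^sup>2 / 2\<close>; this is the origin of the step size bound. Averaging in
  the dual lowers it further by the mean of the Lyapunov distances from \<open>z n\<close> to the
  averaged points. Against these stands \<epsilon> n, the price of \<open>k n > 1\<close>, made
  uniform over \<open>F\<close> by the radius \<omega>. For the resolvents the obstacle is that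
  \<open>C\<close> may be unbounded: the problem is solved on a ball, and the quadratic growth of
  the duality map keeps the solution off the boundary.\<close>

lemma uniformly_smooth_norm_derivative:
  fixes x :: "'a::real_normed_vector"
  assumes "uniformly_smooth TYPE('a)" "norm x = 1"
  obtains p where "\<And>y. ((\<lambda>t. (norm (x + t *\<^sub>R y) - norm x) / t) \<longlongrightarrow> p y) (at 0)"
proof -
  obtain D where D: "uniform_limit (sphere 0 1 \<times> sphere 0 1)
      (\<lambda>t (x::'a, y). (norm (x + t *\<^sub>R y) - norm x) / t) D (at 0)"
    using assms(1) unfolding uniformly_smooth_def by blast
  have unit: "((\<lambda>t. (norm (x + t *\<^sub>R y) - norm x) / t) \<longlongrightarrow> D (x, y)) (at 0)" if "norm y = 1" for y
    using tendsto_uniform_limitI[OF D, of "(x, y)"] that assms(2) by simp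
  have "\<exists>l. ((\<lambda>t. (norm (x + t *\<^sub>R y) - norm x) / t) \<longlongrightarrow> l) (at 0)" for y
  proof (cases "y = 0")
    case True
    then show ?thesis by (auto intro!: exI[of _ 0])
  next
    case False
    \<comment> \<open>Homogeneity: the quotient in direction \<open>y\<close> at time
      \<open>t\<close> is \<open>norm y\<close> times the quotient in the unit direction at time
      \<open>t * norm y\<close>.\<close>
    have lim: "filterlim (\<lambda>t. t * norm y) (at 0) (at 0)"
      using False by (auto simp: filterlim_at eventually_at_filter intro!: tendsto_eq_intros)
    have "norm (y /\<^sub>R norm y) = 1" using False by simp
    from tendsto_mult_left[OF filterlim_compose[OF unit[OF this] lim], of "norm y"]
    have "((\<lambda>t. norm y * ((norm (x + (t * norm y) *\<^sub>R (y /\<^sub>R norm y)) - norm x) / (t * norm y)))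
        \<longlongrightarrow> norm y * D (x, y /\<^sub>R norm y)) (at 0)" .
    then show ?thesis using False by (auto simp: divide_simps)
  qed
  then show ?thesis using that by metis
qed

text \<open>The directional derivative \<open>p\<close> of the norm at \<open>x\<close> is
  subadditive because the norm is convex, and homogeneous also for negative scalars because the
  limit is two-sided; together this makes it linear. A competing \<open>h\<close> lies below every
  difference quotient with positive \<open>t\<close>, hence below \<open>p\<close>, and linearity
  turns this into equality.\<close>

lemma uniformly_smooth_support_functional:
  fixes x :: "'a::real_normed_vector"
  assumes "uniformly_smooth TYPE('a)" "norm x = 1"
  obtains g :: "'a \<Rightarrow>\<^sub>L real" where "norm g = 1" "blinfun_apply g x = 1"
    "\<And>h :: 'a \<Rightarrow>\<^sub>L real. norm h = 1 \<Longrightarrow> blinfun_apply h x = 1 \<Longrightarrow> h = g"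
proof -
  define q where "q = (\<lambda>y t. (norm (x + t *\<^sub>R y) - norm x) / t)"
  obtain p where p: "\<And>y. (q y \<longlongrightarrow> p y) (at 0)"
    using uniformly_smooth_norm_derivative[OF assms] unfolding q_def by metis
  have pr: "(q y \<longlongrightarrow> p y) (at_right 0)" for y
    by (rule tendsto_mono[OF _ p]) (simp add: at_le)
  have scale: "p (s *\<^sub>R y) = s * p y" for s y
  proof (cases "s = 0")
    case True
    have "(q 0 \<longlongrightarrow> 0) (at 0)" by (simp add: q_def)
    then show ?thesis using True tendsto_unique[OF _ p[of 0]] by fastforce
  next
    case False
    have lim: "filterlim (\<lambda>t. t * s) (at 0) (at 0)"
      using False by (auto simp: filterlim_at eventually_at_filter intro!: tendsto_eq_intros)
    have "((\<lambda>t. s * q y (t * s)) \<longlongrightarrow> s * p y) (at 0)"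
      by (intro tendsto_mult_left filterlim_compose[OF p lim])
    moreover have "(\<lambda>t. s * q y (t * s)) = q (s *\<^sub>R y)"
      using False by (auto simp: q_def fun_eq_iff)
    ultimately show ?thesis using tendsto_unique[OF _ p[of "s *\<^sub>R y"]] by force
  qed
  have sub: "p (y + w) \<le> p y + p w" for y w
  proof (rule tendsto_le[of "at_right (0::real)"])
    have lim: "filterlim (\<lambda>t. t * 2) (at 0) (at_right (0::real))"
      by (auto simp: filterlim_at eventually_at_filter intro!: tendsto_eq_intros)
    show "((\<lambda>t. q y (t * 2) + q w (t * 2)) \<longlongrightarrow> p y + p w) (at_right 0)"
      by (intro tendsto_add filterlim_compose[OF p lim])
    have "q (y + w) t \<le> q y (t * 2) + q w (t * 2)" if "t > 0" for t
    proof -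
      have "2 *\<^sub>R (x + t *\<^sub>R (y + w)) = (x + (t * 2) *\<^sub>R y) + (x + (t * 2) *\<^sub>R w)"
        by (simp add: algebra_simps scaleR_2)
      then have "2 * norm (x + t *\<^sub>R (y + w)) \<le> norm (x + (t * 2) *\<^sub>R y) + norm (x + (t * 2) *\<^sub>R w)"
        by (metis norm_scaleR norm_triangle_ineq abs_numeral)
      then show ?thesis using that by (simp add: q_def divide_simps)
    qed
    then show "\<forall>\<^sub>F t in at_right 0. q (y + w) t \<le> q y (t * 2) + q w (t * 2)"
      by (auto simp: eventually_at_filter)
  qed (use pr in auto)
  have "p (y + w) \<ge> p y + p w" for y w
    using sub[of "- y" "- w"] scale[of "-1" y] scale[of "-1" w] scale[of "-1" "y + w"] by simp
  then have add: "p (y + w) = p y + p w" for y w using sub antisym by blast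
  have le: "p y \<le> norm y" for y
  proof (rule tendsto_upperbound[OF pr])
    have "q y t \<le> norm y" if "t > 0" for t
      using norm_triangle_ineq[of x "t *\<^sub>R y"] that by (simp add: q_def divide_simps mult.commute)
    then show "\<forall>\<^sub>F t in at_right 0. q y t \<le> norm y" by (auto simp: eventually_at_filter)
  qed simp
  have abs: "\<bar>p y\<bar> \<le> norm y" for y using le[of y] le[of "- y"] scale[of "-1" y] by auto
  have bl: "bounded_linear p"
    by (rule bounded_linear_intro[of _ 1]) (use add scale abs in auto)
  have px: "p x = 1"
  proof (rule tendsto_unique[OF _ pr])
    have "q x t = 1" if "t > 0" for t
    proof -
      have "x + t *\<^sub>R x = (1 + t) *\<^sub>R x" by (simp add: algebra_simps)
      then have "norm (x + t *\<^sub>R x) = 1 + t" using that assms(2) by simp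
      then show ?thesis using that assms(2) by (simp add: q_def)
    qed
    then show "(q x \<longlongrightarrow> 1) (at_right 0)"
      by (intro tendsto_eventually) (auto simp: eventually_at_filter)
  qed simp
  define g where "g = Blinfun p"
  have g: "blinfun_apply g = p" by (simp add: g_def bl bounded_linear_Blinfun_apply)
  show ?thesis
  proof (rule that[of g])
    have "norm g \<le> 1" by (rule norm_blinfun_bound) (use abs g in auto)
    moreover have "1 \<le> norm g" using norm_blinfun[of g x] px g assms(2) by simp
    ultimately show "norm g = 1" by simp
    show "g x = 1" using px g by simp
    fix h :: "'a \<Rightarrow>\<^sub>L real" assume h: "norm h = 1" "h x = 1"
    have hp: "h y \<le> p y" for y
    proof (rule tendsto_lowerbound[OF pr])
      have "h y \<le> q y t" if "t > 0" for t
      proof -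
        have "h (x + t *\<^sub>R y) \<le> norm (x + t *\<^sub>R y)"
          using norm_blinfun[of h "x + t *\<^sub>R y"] h by simp
        then show ?thesis
          using that h assms(2) by (simp add: q_def blinfun.bilinear_simps divide_simps mult.commute)
      qed
      then show "\<forall>\<^sub>F t in at_right 0. h y \<le> q y t" by (auto simp: eventually_at_filter)
    qed simp
    show "h = g"
    proof (rule blinfun_eqI)
      fix y show "h y = g y"
        using hp[of y] hp[of "- y"] scale[of "-1" y] by (simp add: g blinfun.bilinear_simps)
    qed
  qed
qed

locale uniformly_smooth_space =
  fixes E :: "'a::real_normed_vector itself"
  assumes smooth: "uniformly_smooth TYPE('a)"
begin

text \<open>Gives the \<open>THE\<close> in \<open>duality_map\<close> its meaning: away from 0 the
  functional is the supporting functional of the unit vector \<open>e\<close>, scaled by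
  \<open>norm x\<close>.\<close>

lemma duality_map_ex1:
  fixes x :: 'a
  shows "\<exists>!f :: 'a \<Rightarrow>\<^sub>L real. blinfun_apply f x = (norm x)\<^sup>2 \<and> (norm x)\<^sup>2 = (norm f)\<^sup>2"
proof (cases "x = 0")
  case True
  then show ?thesis by (auto simp: blinfun.bilinear_simps intro!: ex1I[of _ 0])
next
  case False
  define e where "e = x /\<^sub>R norm x"
  have "norm e = 1" "x = norm x *\<^sub>R e" using False by (auto simp: e_def)
  then obtain g :: "'a \<Rightarrow>\<^sub>L real" where g: "norm g = 1" "blinfun_apply g e = 1"
    "\<And>h :: 'a \<Rightarrow>\<^sub>L real. norm h = 1 \<Longrightarrow> blinfun_apply h e = 1 \<Longrightarrow> h = g"
    using uniformly_smooth_support_functional[OF smooth] by metis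
  show ?thesis
  proof (rule ex1I[of _ "norm x *\<^sub>R g"])
    have "g x = norm x" using g(2) False by (simp add: e_def blinfun.bilinear_simps field_simps)
    then show "(norm x *\<^sub>R g) x = (norm x)\<^sup>2 \<and> (norm x)\<^sup>2 = (norm (norm x *\<^sub>R g))\<^sup>2"
      using g(1) by (simp add: blinfun.bilinear_simps power2_eq_square)
    fix f :: "'a \<Rightarrow>\<^sub>L real" assume f: "blinfun_apply f x = (norm x)\<^sup>2 \<and> (norm x)\<^sup>2 = (norm f)\<^sup>2"
    have nf: "norm f = norm x" by (rule power2_eq_imp_eq) (use f in simp_all)
    have "norm (f /\<^sub>R norm x) = 1" using nf False by simp
    moreover have "blinfun_apply (f /\<^sub>R norm x) e = 1"
      using conjunct1[OF f] False by (simp add: e_def blinfun.bilinear_simps power2_eq_square field_simps)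
    ultimately have "f /\<^sub>R norm x = g" by (rule g(3))
    moreover have "norm x *\<^sub>R (f /\<^sub>R norm x) = f" using False by simp
    ultimately show "f = norm x *\<^sub>R g" by metis
  qed
qed

lemma duality_map_characterization:
  fixes x :: 'a
  shows "duality_map x x = (norm x)\<^sup>2 \<and> (norm x)\<^sup>2 = (norm (duality_map x))\<^sup>2"
  using theI'[OF duality_map_ex1[of x]] unfolding duality_map_def .

lemma duality_map_self [simp]: "duality_map x x = (norm x)\<^sup>2" for x :: 'a
  using duality_map_characterization[of x] by (rule conjunct1)

lemma norm_duality_map [simp]: "norm (duality_map x) = norm x" for x :: 'a
  by (rule power2_eq_imp_eq) (use conjunct2[OF duality_map_characterization[of x]] in simp_all)

lemma duality_map_zero [simp]: "duality_map (0 :: 'a) = 0"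
  using norm_duality_map[of 0] unfolding norm_zero norm_eq_zero .

lemma abs_duality_map_le: "\<bar>duality_map x y\<bar> \<le> norm x * norm y" for x y :: 'a
  using norm_blinfun[of "duality_map x" y] by simp

lemma duality_map_le: "duality_map x y \<le> norm x * norm y" for x y :: 'a
  using abs_duality_map_le[of x y] by simp

text \<open>Only the second difference of the norm enters, so the derivative of the norm is not needed.\<close>

lemma normalized_duality_map_continuous:
  fixes x :: 'a
  assumes "x \<noteq> 0"
  shows "((\<lambda>w. duality_map w /\<^sub>R norm w) \<longlongrightarrow> duality_map x /\<^sub>R norm x) (at x)"
proof (rule tendstoI)
  fix e :: real assume "e > 0"
  define P where "P = (\<lambda>w::'a. duality_map w /\<^sub>R norm w)"
  define n where "n = norm x"
  have n: "n > 0" using assms by (simp add: n_def)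
  obtain D where D: "uniform_limit (sphere 0 1 \<times> sphere 0 1)
      (\<lambda>t (x::'a, y). (norm (x + t *\<^sub>R y) - norm x) / t) D (at 0)"
    using smooth unfolding uniformly_smooth_def by blast
  obtain s0 where "s0 > 0" and s0: "\<And>t y z. 0 < \<bar>t\<bar> \<Longrightarrow> \<bar>t\<bar> < s0 \<Longrightarrow> norm y = 1 \<Longrightarrow> norm z = 1 \<Longrightarrow>
      \<bar>(norm (y + t *\<^sub>R z) - norm y) / t - D (y, z)\<bar> < e / 8"
    using D[unfolded uniform_limit_at_iff, rule_format, of "e / 8"] \<open>e > 0\<close>
    by (fastforce simp: dist_real_def)
  define s where "s = s0 / 2"
  have s: "s > 0" "s < s0" using \<open>s0 > 0\<close> by (auto simp: s_def)
  \<comment> \<open>Using \<open>s\<close> and \<open>- s\<close> in the same uniform limit cancels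
    \<open>D\<close>, and the two errors \<open>e / 8\<close> add up to \<open>e / 4\<close>. The
    factor \<open>n\<close> moves the base point from the unit sphere to \<open>x\<close>.\<close>
  have second: "norm (x + (n * s) *\<^sub>R w) + norm (x - (n * s) *\<^sub>R w) - 2 * n \<le> n * s * e / 4"
    if "norm w = 1" for w
  proof -
    define v where "v = x /\<^sub>R n"
    have v: "norm v = 1" "x = n *\<^sub>R v" using n assms by (auto simp: v_def n_def)
    have "\<bar>(norm (v + s *\<^sub>R w) - 1) / s - D (v, w)\<bar> < e / 8"
      "\<bar>- ((norm (v - s *\<^sub>R w) - 1) / s) - D (v, w)\<bar> < e / 8"
      using s0[of s v w] s0[of "- s" v w] s v(1) that by auto
    then have "(norm (v + s *\<^sub>R w) - 1) / s + (norm (v - s *\<^sub>R w) - 1) / s < e / 4"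
      by linarith
    then have "norm (v + s *\<^sub>R w) + norm (v - s *\<^sub>R w) - 2 \<le> s * e / 4"
      unfolding add_divide_distrib[symmetric] pos_divide_less_eq[OF s(1)] by (simp add: mult.commute)
    then have "n * (norm (v + s *\<^sub>R w) + norm (v - s *\<^sub>R w) - 2) \<le> n * (s * e / 4)"
      using n by (intro mult_left_mono) auto
    moreover have "norm (x + (n * s) *\<^sub>R w) = n * norm (v + s *\<^sub>R w)"
      "norm (x - (n * s) *\<^sub>R w) = n * norm (v - s *\<^sub>R w)"
      using n v(2) by (auto simp flip: scaleR_scaleR scaleR_add_right scaleR_diff_right)
    ultimately show ?thesis by (simp add: algebra_simps)
  qed
  have Pself: "P w w = norm w" "norm (P w) = 1" if "w \<noteq> 0" for w
    using that by (auto simp: P_def blinfun.bilinear_simps power2_eq_square)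
  have Ple: "P w v \<le> norm v" if "w \<noteq> 0" for w v
    using norm_blinfun[of "P w" v] Pself[OF that] by simp
  \<comment> \<open>\<open>P w\<close> is tested at \<open>w + t *\<^sub>R v\<close> and
    \<open>P x\<close> at \<open>x - t *\<^sub>R v\<close>. Both have norm one, so adding the bounds
    gives a second difference, up to \<open>2 * norm (w - x)\<close> for replacing \<open>w\<close>
    by \<open>x\<close>.\<close>
  have diff: "(P w - P x) v \<le> e / 4 + 2 * norm (w - x) / (n * s)" if "w \<noteq> 0" "norm v = 1" for w v
  proof -
    define t where "t = n * s"
    have t: "t > 0" using n s by (simp add: t_def)
    have "P w (w + t *\<^sub>R v) \<le> norm (w + t *\<^sub>R v)" "P x (x - t *\<^sub>R v) \<le> norm (x - t *\<^sub>R v)"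
      using Ple that assms by auto
    then have "t * (P w - P x) v \<le> norm (w + t *\<^sub>R v) - norm w + norm (x - t *\<^sub>R v) - norm x"
      using Pself that assms by (simp add: blinfun.bilinear_simps algebra_simps)
    moreover have "norm (w + t *\<^sub>R v) \<le> norm (x + t *\<^sub>R v) + norm (w - x)"
      using norm_triangle_ineq[of "x + t *\<^sub>R v" "w - x"] by (simp add: algebra_simps)
    moreover have "norm x \<le> norm w + norm (w - x)"
      by (metis norm_minus_commute norm_triangle_sub)
    ultimately have "t * (P w - P x) v \<le> t * e / 4 + 2 * norm (w - x)"
      using second[OF that(2)] by (simp add: t_def n_def)
    then show ?thesis using t unfolding t_def[symmetric] by (simp add: field_simps)
  qed
  have bound: "norm (P w - P x) \<le> e / 4 + 2 * norm (w - x) / (n * s)" if "w \<noteq> 0" for w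
  proof (rule norm_blinfun_bound)
    show "0 \<le> e / 4 + 2 * norm (w - x) / (n * s)" using n s \<open>e > 0\<close> by simp
    fix v
    show "norm ((P w - P x) v) \<le> (e / 4 + 2 * norm (w - x) / (n * s)) * norm v"
    proof (cases "v = 0")
      case False
      define v' where "v' = v /\<^sub>R norm v"
      have v': "norm v' = 1" "v = norm v *\<^sub>R v'" using False by (auto simp: v'_def)
      have "norm ((P w - P x) v) = norm v * \<bar>(P w - P x) v'\<bar>"
        using False by (simp add: v'_def blinfun.bilinear_simps abs_mult)
      moreover have "\<bar>(P w - P x) v'\<bar> \<le> e / 4 + 2 * norm (w - x) / (n * s)"
        using diff[OF that, of v'] diff[OF that, of "- v'"] v'(1) by (auto simp: blinfun.bilinear_simps abs_le_iff)
      ultimately show ?thesis by (simp add: mult.commute[of _ "norm v"] mult_left_mono)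
    qed (simp add: blinfun.bilinear_simps)
  qed
  have "\<forall>\<^sub>F w in at x. w \<noteq> 0" using assms by (simp add: eventually_neq_at_within)
  moreover have "\<forall>\<^sub>F w in at x. dist w x < e * n * s / 4"
    by (rule tendstoD[OF tendsto_ident_at]) (use \<open>e > 0\<close> n s in simp)
  ultimately show "\<forall>\<^sub>F w in at x. dist (duality_map w /\<^sub>R norm w) (duality_map x /\<^sub>R norm x) < e"
  proof eventually_elim
    case (elim w)
    have "2 * norm (w - x) / (n * s) \<le> e / 2"
      using elim(2) n s by (simp add: dist_norm field_simps)
    then have "norm (P w - P x) < e" using bound[OF elim(1)] \<open>e > 0\<close> by simp
    then show ?case by (simp add: P_def dist_norm)
  qed
qed

lemma isCont_duality_map: "isCont duality_map (x :: 'a)"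
proof (cases "x = 0")
  case True
  have "((\<lambda>w::'a. norm (duality_map w)) \<longlongrightarrow> 0) (at 0)"
    by (auto intro!: tendsto_eq_intros)
  then show ?thesis using True by (simp add: isCont_def tendsto_norm_zero_cancel)
next
  case False
  have "((\<lambda>w. norm w *\<^sub>R (duality_map w /\<^sub>R norm w)) \<longlongrightarrow> norm x *\<^sub>R (duality_map x /\<^sub>R norm x)) (at x)"
    by (intro tendsto_intros normalized_duality_map_continuous False)
  moreover have "\<forall>\<^sub>F w in at x. norm w *\<^sub>R (duality_map w /\<^sub>R norm w) = duality_map w"
    using eventually_neq_at_within[of 0 x UNIV]  by eventually_elim auto
  ultimately show ?thesis
    using False by (simp add: isCont_def tendsto_cong)
qed

lemma tendsto_duality_map [tendsto_intros]:
  fixes g :: "'b \<Rightarrow> 'a"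
  assumes "(g \<longlongrightarrow> x) G"
  shows "((\<lambda>t. duality_map (g t)) \<longlongrightarrow> duality_map x) G"
  using isCont_tendsto_compose[OF isCont_duality_map assms] .

end

section \<open>Consequences of 2-uniform convexity\<close>

lemma two_uniformly_convex_unit:
  assumes "two_uniformly_convex TYPE('a::real_normed_vector)"
  obtains \<kappa> where "\<kappa> > 0"
    "\<And>u v :: 'a. norm u = 1 \<Longrightarrow> norm v = 1 \<Longrightarrow> norm ((u + v) /\<^sub>R 2) \<le> 1 - \<kappa> * (norm (u - v))\<^sup>2"
proof -
  obtain \<kappa> where \<kappa>: "\<kappa> > 0" "\<And>\<epsilon>. \<epsilon> \<in> {0<..2} \<Longrightarrow> \<kappa> * \<epsilon>\<^sup>2 \<le> modulus_of_convexity TYPE('a) \<epsilon>"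
    using assms unfolding two_uniformly_convex_def by blast
  have mid: "norm ((u + v) /\<^sub>R 2) \<le> 1" if "norm u = 1" "norm v = 1" for u v :: 'a
    using norm_triangle_ineq[of u v] that by simp
  have "norm ((u + v) /\<^sub>R 2) \<le> 1 - \<kappa> * (norm (u - v))\<^sup>2" if uv: "norm u = 1" "norm v = 1" for u v :: 'a
  proof (cases "u = v")
    case True
    then show ?thesis using mid[OF uv] by simp
  next
    case False
    define \<epsilon> where "\<epsilon> = norm (u - v)"
    have "\<epsilon> \<in> {0<..2}" using False norm_triangle_ineq4[of u v] uv by (simp add: \<epsilon>_def)
    then have "\<kappa> * \<epsilon>\<^sup>2 \<le> modulus_of_convexity TYPE('a) \<epsilon>" by (rule \<kappa>(2))
    also have "\<dots> \<le> 1 - norm ((u + v) /\<^sub>R 2)"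
      unfolding modulus_of_convexity_def
    proof (rule cInf_lower)
      show "1 - norm ((u + v) /\<^sub>R 2) \<in> insert 1 {1 - norm ((x + y) /\<^sub>R 2) |x y::'a.
          norm x = 1 \<and> norm y = 1 \<and> \<epsilon> \<le> norm (x - y)}"
        using uv unfolding \<epsilon>_def by blast
      have "0 \<le> s" if "s \<in> insert 1 {1 - norm ((x + y) /\<^sub>R 2) |x y::'a.
          norm x = 1 \<and> norm y = 1 \<and> \<epsilon> \<le> norm (x - y)}" for s
        using that mid by fastforce
      then show "bdd_below (insert 1 {1 - norm ((x + y) /\<^sub>R 2) |x y::'a.
          norm x = 1 \<and> norm y = 1 \<and> \<epsilon> \<le> norm (x - y)})"
        by (rule bdd_belowI)
    qed
    finally show ?thesis by (simp add: \<epsilon>_def)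
  qed
  then show ?thesis using that \<kappa>(1) by blast
qed

text \<open>The unit sphere estimate is spread to all vectors by splitting the difference of
  \<open>x\<close> and \<open>y\<close> into a difference of lengths, \<open>s - t\<close>, and one
  of directions, \<open>t * e\<close>. Plain convexity of the square pays for the first, the modulus
  for the second.\<close>

lemma two_uniformly_convex_midpoint:
  assumes "two_uniformly_convex TYPE('a::real_normed_vector)"
  obtains \<kappa> where "\<kappa> > 0"
    "\<And>x y :: 'a. (norm ((x + y) /\<^sub>R 2))\<^sup>2 \<le> (norm x)\<^sup>2 / 2 + (norm y)\<^sup>2 / 2 - \<kappa> * (norm (x - y))\<^sup>2"
proof -
  obtain \<kappa>0 where \<kappa>0: "\<kappa>0 > 0"
    "\<And>u v :: 'a. norm u = 1 \<Longrightarrow> norm v = 1 \<Longrightarrow> norm ((u + v) /\<^sub>R 2) \<le> 1 - \<kappa>0 * (norm (u - v))\<^sup>2"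
    using two_uniformly_convex_unit[OF assms] by metis
  \<comment> \<open>Since \<open>(norm (x - y))\<^sup>2\<close> is at most
    \<open>2 * (s - t)\<^sup>2 + 2 * (t * e)\<^sup>2\<close>, twice \<kappa> has to stay below the
    available coefficients \<open>1 / 4\<close> and \<open>\<kappa>0\<close>.\<close>
  define \<kappa> where "\<kappa> = min (1 / 8) (\<kappa>0 / 2)"
  have \<kappa>: "\<kappa> > 0" "\<kappa> \<le> 1 / 8" "\<kappa> \<le> \<kappa>0 / 2" using \<kappa>0(1) by (auto simp: \<kappa>_def)
  have ordered: "(norm ((x + y) /\<^sub>R 2))\<^sup>2 \<le> (norm x)\<^sup>2 / 2 + (norm y)\<^sup>2 / 2 - \<kappa> * (norm (x - y))\<^sup>2"
    if le: "norm y \<le> norm x" for x y :: 'a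
  proof (cases "y = 0")
    case True
    have "\<kappa> * (norm x)\<^sup>2 \<le> 1 / 4 * (norm x)\<^sup>2" using \<kappa> by (intro mult_right_mono) auto
    then show ?thesis using True by (simp add: power2_eq_square)
  next
    case False
    define s t where "s = norm x" and "t = norm y"
    define u v where "u = x /\<^sub>R s" and "v = y /\<^sub>R t"
    define e where "e = norm (u - v)"
    \<comment> \<open>The gain from convexity. It does not exceed \<open>t\<close>, hence not the
      mean \<open>m\<close> of \<open>s\<close> and \<open>t\<close>, so squaring
      \<open>m - q\<close> still saves at least \<open>m * q\<close>.\<close>
    define q where "q = t * (\<kappa>0 * e\<^sup>2)"
    have t: "0 < t" "t \<le> s" using False le by (auto simp: s_def t_def)
    then have x: "x = s *\<^sub>R u" and y: "y = t *\<^sub>R v" by (auto simp: u_def v_def)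
    have "x \<noteq> 0" using False le by auto
    then have uv: "norm u = 1" "norm v = 1" using False by (auto simp: u_def v_def s_def t_def)
    have uve: "norm ((u + v) /\<^sub>R 2) \<le> 1 - \<kappa>0 * e\<^sup>2" using \<kappa>0(2)[OF uv] by (simp add: e_def)
    have "0 \<le> norm ((u + v) /\<^sub>R 2)" by simp
    then have "\<kappa>0 * e\<^sup>2 \<le> 1" using uve by linarith
    then have q: "0 \<le> q" "q \<le> t" using t \<kappa>0(1) by (auto simp: q_def mult_left_le)
    have "(x + y) /\<^sub>R 2 = t *\<^sub>R ((u + v) /\<^sub>R 2) + ((s - t) / 2) *\<^sub>R u"
      unfolding x y by (simp add: algebra_simps flip: scaleR_add_left) (simp flip: scaleR_add_left add: field_simps)
    then have "norm ((x + y) /\<^sub>R 2) \<le> t * norm ((u + v) /\<^sub>R 2) + (s - t) / 2"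
      using norm_triangle_ineq[of "t *\<^sub>R ((u + v) /\<^sub>R 2)" "((s - t) / 2) *\<^sub>R u"] t uv by simp
    also have "\<dots> \<le> t * (1 - \<kappa>0 * e\<^sup>2) + (s - t) / 2" using uve t by simp
    also have "\<dots> = (s + t) / 2 - q" by (simp add: q_def field_simps)
    finally have "(norm ((x + y) /\<^sub>R 2))\<^sup>2 \<le> ((s + t) / 2 - q)\<^sup>2" by (simp add: power_mono)
    also have "\<dots> \<le> ((s + t) / 2)\<^sup>2 - (s + t) / 2 * q"
    proof -
      have "q * q \<le> (s + t) / 2 * q" using q t by (intro mult_right_mono) auto
      moreover have "(m - q)\<^sup>2 \<le> m\<^sup>2 - m * q" if "q * q \<le> m * q" for m
        using that by (simp add: power2_eq_square algebra_simps)
      ultimately show ?thesis by blast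
    qed
    also have "\<dots> \<le> ((s + t) / 2)\<^sup>2 - \<kappa>0 * (t * e)\<^sup>2"
    proof -
      have "t * q \<le> (s + t) / 2 * q" using q t by (intro mult_right_mono) auto
      then show ?thesis by (simp add: q_def power2_eq_square mult_ac)
    qed
    finally have 1: "(norm ((x + y) /\<^sub>R 2))\<^sup>2 \<le> s\<^sup>2 / 2 + t\<^sup>2 / 2 - (s - t)\<^sup>2 / 4 - \<kappa>0 * (t * e)\<^sup>2"
      by (simp add: power2_eq_square field_simps)
    have "x - y = (s - t) *\<^sub>R u + t *\<^sub>R (u - v)" unfolding x y by (simp add: algebra_simps)
    then have "norm (x - y) \<le> (s - t) + t * e"
      using norm_triangle_ineq[of "(s - t) *\<^sub>R u" "t *\<^sub>R (u - v)"] t uv by (simp add: e_def)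
    then have "(norm (x - y))\<^sup>2 \<le> ((s - t) + t * e)\<^sup>2" by (simp add: power_mono)
    also have "\<dots> \<le> 2 * (s - t)\<^sup>2 + 2 * (t * e)\<^sup>2"
      using sum_squares_bound[of "s - t" "t * e"] by (simp add: power2_sum)
    finally have "\<kappa> * (norm (x - y))\<^sup>2 \<le> \<kappa> * (2 * (s - t)\<^sup>2 + 2 * (t * e)\<^sup>2)"
      using \<kappa> by (intro mult_left_mono) auto
    also have "\<dots> = 2 * \<kappa> * (s - t)\<^sup>2 + 2 * \<kappa> * (t * e)\<^sup>2" by (simp add: algebra_simps)
    also have "\<dots> \<le> 1 / 4 * (s - t)\<^sup>2 + \<kappa>0 * (t * e)\<^sup>2"
      using \<kappa> by (intro add_mono mult_right_mono) auto
    finally show ?thesis using 1 by (simp add: s_def t_def)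
  qed
  have "(norm ((x + y) /\<^sub>R 2))\<^sup>2 \<le> (norm x)\<^sup>2 / 2 + (norm y)\<^sup>2 / 2 - \<kappa> * (norm (x - y))\<^sup>2" for x y :: 'a
    using ordered[of x y] ordered[of y x] by (cases "norm y \<le> norm x") (simp_all add: add.commute norm_minus_commute)
  then show ?thesis using that \<kappa>(1) by blast
qed

locale smooth_two_convex_space = uniformly_smooth_space E for E :: "'a::banach itself" +
  assumes convex: "two_uniformly_convex TYPE('a)"
begin

definition convexity_constant :: real where
  "convexity_constant = (SOME \<kappa>. \<kappa> > 0 \<and> (\<forall>x y :: 'a.
     (norm ((x + y) /\<^sub>R 2))\<^sup>2 \<le> (norm x)\<^sup>2 / 2 + (norm y)\<^sup>2 / 2 - \<kappa> * (norm (x - y))\<^sup>2))"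

lemma convexity_constant:
  "convexity_constant > 0 \<and> (\<forall>x y :: 'a.
     (norm ((x + y) /\<^sub>R 2))\<^sup>2 \<le> (norm x)\<^sup>2 / 2 + (norm y)\<^sup>2 / 2 - convexity_constant * (norm (x - y))\<^sup>2)"
  unfolding convexity_constant_def by (rule someI_ex) (metis two_uniformly_convex_midpoint[OF convex])

lemma convexity_constant_pos: "convexity_constant > 0"
  using convexity_constant by (rule conjunct1)

lemma midpoint_norm_le:
  fixes x y :: 'a
  shows "(norm ((x + y) /\<^sub>R 2))\<^sup>2 \<le> (norm x)\<^sup>2 / 2 + (norm y)\<^sup>2 / 2 - convexity_constant * (norm (x - y))\<^sup>2"
  using convexity_constant by blast

text \<open>Evaluate \<open>duality_map y\<close> at the midpoint of \<open>x\<close> and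
  \<open>y\<close>: the product of norms splits into half squares, and the midpoint inequality
  leaves the squared distance as surplus.\<close>

lemma lyapunov_ge: "2 * convexity_constant * (norm (x - y))\<^sup>2 \<le> lyapunov x y" for x y :: 'a
proof -
  have "duality_map y ((x + y) /\<^sub>R 2) \<le> norm y * norm ((x + y) /\<^sub>R 2)" by (rule duality_map_le)
  also have "\<dots> \<le> (norm y)\<^sup>2 / 2 + (norm ((x + y) /\<^sub>R 2))\<^sup>2 / 2"
    using sum_squares_bound[of "norm y" "norm ((x + y) /\<^sub>R 2)"] by simp
  also have "\<dots> \<le> (norm y)\<^sup>2 / 2 + ((norm x)\<^sup>2 / 2 + (norm y)\<^sup>2 / 2 - convexity_constant * (norm (x - y))\<^sup>2) / 2"
    using midpoint_norm_le[of x y] by simp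
  finally show ?thesis by (simp add: lyapunov_def blinfun.bilinear_simps)
qed

lemma lyapunov_nonneg: "0 \<le> lyapunov x y" for x y :: 'a
  by (rule order_trans[OF _ lyapunov_ge]) (simp add: convexity_constant_pos less_imp_le)

lemma lyapunov_self [simp]: "lyapunov x x = 0" for x :: 'a
  by (simp add: lyapunov_def)

lemma lyapunov_le: "lyapunov x y \<le> (norm x + norm y)\<^sup>2" for x y :: 'a
  using abs_duality_map_le[of y x] by (simp add: lyapunov_def power2_sum abs_le_iff mult.commute)

lemma lyapunov_three_point:
  "lyapunov x y = lyapunov x w + lyapunov w y + 2 * (duality_map w - duality_map y) (x - w)" for x y w :: 'a
  by (simp add: lyapunov_def blinfun.bilinear_simps)

lemma lyapunov_add_commute:
  "lyapunov x y + lyapunov y x = 2 * (duality_map x - duality_map y) (x - y)" for x y :: 'a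
  by (simp add: lyapunov_def blinfun.bilinear_simps)

lemma tendsto_lyapunov [tendsto_intros]:
  fixes x y :: 'a
  assumes "(g \<longlongrightarrow> x) G" "(h \<longlongrightarrow> y) G"
  shows "((\<lambda>t. lyapunov (g t) (h t)) \<longlongrightarrow> lyapunov x y) G"
  unfolding lyapunov_def using assms by (intro tendsto_intros)

lemma lyapunov_tendsto_zeroD:
  fixes g h :: "'b \<Rightarrow> 'a"
  assumes "((\<lambda>t. lyapunov (g t) (h t)) \<longlongrightarrow> 0) G"
  shows "((\<lambda>t. g t - h t) \<longlongrightarrow> 0) G"
proof -
  have "((\<lambda>t. (norm (g t - h t))\<^sup>2) \<longlongrightarrow> 0) G"
  proof (rule tendsto_sandwich[OF _ _ tendsto_const])
    show "\<forall>\<^sub>F t in G. (norm (g t - h t))\<^sup>2 \<le> lyapunov (g t) (h t) / (2 * convexity_constant)"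
      using lyapunov_ge convexity_constant_pos by (simp add: field_simps)
    show "((\<lambda>t. lyapunov (g t) (h t) / (2 * convexity_constant)) \<longlongrightarrow> 0) G"
      by (rule tendsto_divide_zero[OF assms])
  qed simp
  then show ?thesis by (simp add: tendsto_norm_zero_iff)
qed

lemma duality_map_strongly_monotone:
  "2 * convexity_constant * (norm (x - y))\<^sup>2 \<le> (duality_map x - duality_map y) (x - y)" for x y :: 'a
  using lyapunov_ge[of x y] lyapunov_ge[of y x] lyapunov_add_commute[of x y]
  by (simp add: norm_minus_commute)

lemma duality_map_expansive:
  "2 * convexity_constant * norm (x - y) \<le> norm (duality_map x - duality_map y)" for x y :: 'a
proof (cases "x = y")
  case False
  have "norm (x - y) * (2 * convexity_constant * norm (x - y)) \<le> norm (x - y) * norm (duality_map x - duality_map y)"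
    using duality_map_strongly_monotone[of x y] norm_blinfun[of "duality_map x - duality_map y" "x - y"]
    by (simp add: power2_eq_square mult_ac abs_le_iff)
  then show ?thesis using False by (simp del: mult.assoc)
qed simp

text \<open>The set of admissible constants is nonempty by expansiveness of the duality map and closed
  from above, so the \<open>GREATEST\<close> in the definition is attained.\<close>

lemma uniform_convexity_c:
  defines "c \<equiv> uniform_convexity_c TYPE('a)"
  shows "0 < c" and "\<And>x y :: 'a. norm (x - y) \<le> 2 / c\<^sup>2 * norm (duality_map x - duality_map y)"
proof -
  define P where "P = (\<lambda>c::real. 0 < c \<and> c \<le> 1 \<and>
    (\<forall>x y :: 'a. norm (x - y) \<le> 2 / c\<^sup>2 * norm (duality_map x - duality_map y)))"
  \<comment> \<open>Expansiveness with factor \<open>2 * convexity_constant\<close> gives the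
    required estimate once \<open>c0\<^sup>2\<close> is at most
    \<open>4 * convexity_constant\<close>; the 1 enforces the upper bound on
    \<open>c\<close>.\<close>
  define c0 where "c0 = sqrt (min 1 (4 * convexity_constant))"
  have "c0\<^sup>2 = min 1 (4 * convexity_constant)" using convexity_constant_pos by (simp add: c0_def)
  then have c0: "0 < c0" "c0 \<le> 1" "c0\<^sup>2 \<le> 4 * convexity_constant"
    using convexity_constant_pos by (auto simp: c0_def)
  have "P c0"
    unfolding P_def
  proof (intro conjI allI)
    fix x y :: 'a
    have "c0\<^sup>2 * norm (x - y) \<le> 4 * convexity_constant * norm (x - y)"
      using c0 by (intro mult_right_mono) auto
    then show "norm (x - y) \<le> 2 / c0\<^sup>2 * norm (duality_map x - duality_map y)"
      using duality_map_expansive[of x y] c0(1) by (simp add: field_simps)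
  qed (use c0 in auto)
  define s where "s = Sup {c. P c}"
  have bdd: "bdd_above {c. P c}" by (rule bdd_aboveI[of _ 1]) (auto simp: P_def)
  have up: "c \<le> s" if "P c" for c unfolding s_def using that bdd by (auto intro: cSup_upper)
  have "P s"
    unfolding P_def
  proof (intro conjI allI)
    show "0 < s" using up[OF \<open>P c0\<close>] c0 by simp
    show "s \<le> 1" unfolding s_def using \<open>P c0\<close> by (intro cSup_least) (auto simp: P_def)
    fix x y :: 'a
    define l r where "l = norm (x - y)" and "r = 2 * norm (duality_map x - duality_map y)"
    \<comment> \<open>After taking square roots the condition is linear in \<open>c\<close>, so it
      passes to the supremum.\<close>
    have c: "c * sqrt l \<le> sqrt r" if "P c" for c
    proof -
      have "c\<^sup>2 * l \<le> r" using that by (auto simp: P_def l_def r_def field_simps)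
      then have "sqrt (c\<^sup>2 * l) \<le> sqrt r" by simp
      then show ?thesis using that by (simp add: real_sqrt_mult P_def)
    qed
    have "s * sqrt l \<le> sqrt r"
    proof (cases "l = 0")
      case False
      then have "l > 0" by (simp add: l_def)
      have "s \<le> sqrt r / sqrt l"
        unfolding s_def
      proof (rule cSup_least)
        fix c assume "c \<in> {c. P c}"
        then show "c \<le> sqrt r / sqrt l" using c[of c] \<open>l > 0\<close> by (simp add: field_simps)
      qed (use \<open>P c0\<close> in auto)
      then show ?thesis using \<open>l > 0\<close> by (simp add: field_simps)
    qed (simp add: r_def)
    then have "(s * sqrt l)\<^sup>2 \<le> (sqrt r)\<^sup>2" using \<open>0 < s\<close> by (intro power_mono) (auto simp: l_def)
    then have "s\<^sup>2 * l \<le> r" by (simp add: power_mult_distrib l_def r_def)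
    then show "norm (x - y) \<le> 2 / s\<^sup>2 * norm (duality_map x - duality_map y)"
      using \<open>0 < s\<close> by (simp add: l_def r_def field_simps)
  qed
  have "c = Greatest P" by (simp add: c_def uniform_convexity_c_def P_def)
  also have "\<dots> = s" by (rule Greatest_equality) (use \<open>P s\<close> up in auto)
  finally have "P c" using \<open>P s\<close> by simp
  then show "0 < c" and "\<And>x y :: 'a. norm (x - y) \<le> 2 / c\<^sup>2 * norm (duality_map x - duality_map y)"
    by (auto simp: P_def)
qed

end

section \<open>Minimizers, generalized projections and surjectivity of the duality map\<close>

lemma is_arg_min_arg_min_on:
  fixes h :: "'a \<Rightarrow> 'b::linorder"
  assumes "w \<in> D" "\<And>y. y \<in> D \<Longrightarrow> h w \<le> h y"
  shows "is_arg_min h (\<lambda>y. y \<in> D) (arg_min_on h D)"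
  unfolding arg_min_on_def arg_min_def
  by (rule someI[of _ w]) (use assms in \<open>auto simp: is_arg_min_linorder\<close>)

context smooth_two_convex_space
begin

text \<open>With \<open>f = duality_map x\<close> the functional is \<open>lyapunov y x\<close> up
  to a constant, which yields projections; with \<open>D = UNIV\<close> it yields surjectivity of
  the duality map. The midpoint of two near-minimizers cannot fall below the infimum, so minimizing
  sequences are Cauchy.\<close>

lemma quadratic_minimizer_exists:
  fixes D :: "'a set" and f :: "'a \<Rightarrow>\<^sub>L real"
  assumes "D \<noteq> {}" "closed D" "convex D"
  obtains w where "w \<in> D" "\<And>y. y \<in> D \<Longrightarrow> (norm w)\<^sup>2 - 2 * f w \<le> (norm y)\<^sup>2 - 2 * f y"
proof -
  define h where "h = (\<lambda>y. (norm y)\<^sup>2 - 2 * f y)"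
  define m where "m = Inf (h ` D)"
  have lower: "- (norm f)\<^sup>2 \<le> h y" for y
  proof -
    have "f y \<le> norm f * norm y" using norm_blinfun[of f y] by simp
    then show ?thesis using sum_squares_bound[of "norm f" "norm y"] unfolding h_def by linarith
  qed
  then have bdd: "bdd_below (h ` D)" by (intro bdd_belowI[of _ "- (norm f)\<^sup>2"]) auto
  have m_le: "m \<le> h y" if "y \<in> D" for y unfolding m_def using that bdd by (auto intro: cInf_lower)
  have "\<exists>y\<in>D. h y < m + inverse (real (Suc n))" for n
    using cInf_lessD[of "h ` D" "m + inverse (real (Suc n))"] assms(1) by (auto simp: m_def)
  then obtain v where v: "\<And>n. v n \<in> D" "\<And>n. h (v n) < m + inverse (real (Suc n))" by metis
  have mid: "m \<le> h p / 2 + h q / 2 - convexity_constant * (norm (p - q))\<^sup>2" if "p \<in> D" "q \<in> D" for p q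
  proof -
    have "(p + q) /\<^sub>R 2 = (1 / 2) *\<^sub>R p + (1 / 2) *\<^sub>R q" by (simp add: scaleR_add_right)
    then have "(p + q) /\<^sub>R 2 \<in> D" using convexD[OF assms(3) that, of "1 / 2" "1 / 2"] by simp
    then have "m \<le> h ((p + q) /\<^sub>R 2)" by (rule m_le)
    moreover have "f ((p + q) /\<^sub>R 2) = f p / 2 + f q / 2"
      by (simp add: blinfun.bilinear_simps)
    ultimately show ?thesis using midpoint_norm_le[of p q] unfolding h_def by argo
  qed
  have "Cauchy v"
  proof (rule CauchyI)
    fix e :: real assume "e > 0"
    then have "convexity_constant * e\<^sup>2 > 0" using convexity_constant_pos by simp
    then obtain N where N: "inverse (real (Suc N)) < convexity_constant * e\<^sup>2"
      using reals_Archimedean by blast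
    have "norm (v i - v j) < e" if "i \<ge> N" "j \<ge> N" for i j
    proof -
      have "inverse (real (Suc i)) \<le> inverse (real (Suc N))" "inverse (real (Suc j)) \<le> inverse (real (Suc N))"
        using that by auto
      then have "convexity_constant * (norm (v i - v j))\<^sup>2 < convexity_constant * e\<^sup>2"
        using mid[OF v(1)[of i] v(1)[of j]] v(2)[of i] v(2)[of j] N by linarith
      then have "(norm (v i - v j))\<^sup>2 < e\<^sup>2" using convexity_constant_pos by simp
      then show ?thesis using \<open>e > 0\<close> by (simp add: power2_less_imp_less)
    qed
    then show "\<exists>M. \<forall>i\<ge>M. \<forall>j\<ge>M. norm (v i - v j) < e" by blast
  qed
  then obtain w where w: "v \<longlonglongrightarrow> w" using Cauchy_convergent_iff convergent_def by blast
  have "(\<lambda>n. h (v n)) \<longlonglongrightarrow> h w" unfolding h_def by (intro tendsto_intros w)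
  moreover have "(\<lambda>n. m + inverse (real (Suc n))) \<longlonglongrightarrow> m + 0"
    by (intro tendsto_intros LIMSEQ_inverse_real_of_nat)
  moreover have "h (v n) \<le> m + inverse (real (Suc n))" for n by (rule less_imp_le[OF v(2)])
  ultimately have "h w \<le> m + 0" by (intro LIMSEQ_le[of "\<lambda>n. h (v n)"]) blast+
  then have "h w \<le> h y" if "y \<in> D" for y using m_le[OF that] by linarith
  moreover have "w \<in> D" using closed_sequentially[OF assms(2) v(1) w] .
  ultimately show ?thesis using that[of w] unfolding h_def by blast
qed

text \<open>Compare \<open>w\<close> with \<open>v = w + t *\<^sub>R (y - w)\<close>. Nonnegativity
  of \<open>lyapunov w v\<close> acts as the subgradient inequality of the squared norm at
  \<open>v\<close>; after division by \<open>t\<close>, continuity of the duality map brings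
  \<open>v\<close> back to \<open>w\<close>.\<close>

lemma quadratic_minimizer_variational:
  fixes D :: "'a set" and f :: "'a \<Rightarrow>\<^sub>L real"
  assumes D: "convex D" "w \<in> D" "y \<in> D"
    and min: "\<And>y. y \<in> D \<Longrightarrow> (norm w)\<^sup>2 - 2 * f w \<le> (norm y)\<^sup>2 - 2 * f y"
  shows "f (y - w) \<le> duality_map w (y - w)"
proof (rule tendsto_le[of "at_right (0::real)"])
  have "((\<lambda>t. duality_map (w + t *\<^sub>R (y - w)) (y - w)) \<longlongrightarrow> duality_map (w + 0 *\<^sub>R (y - w)) (y - w)) (at_right 0)"
    by (intro tendsto_intros)
  then show "((\<lambda>t. duality_map (w + t *\<^sub>R (y - w)) (y - w)) \<longlongrightarrow> duality_map w (y - w)) (at_right 0)"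
    by simp
  have "f (y - w) \<le> duality_map (w + t *\<^sub>R (y - w)) (y - w)" if t: "0 < t" "t < 1" for t
  proof -
    define v where "v = w + t *\<^sub>R (y - w)"
    have "v = (1 - t) *\<^sub>R w + t *\<^sub>R y" by (simp add: v_def algebra_simps)
    then have "v \<in> D" using convexD[OF D, of "1 - t" t] t by simp
    from min[OF this] have "2 * t * f (y - w) \<le> (norm v)\<^sup>2 - (norm w)\<^sup>2"
      by (simp add: v_def blinfun.bilinear_simps algebra_simps)
    also have "\<dots> \<le> 2 * t * duality_map v (y - w)"
    proof -
      have "duality_map v w = (norm v)\<^sup>2 - t * duality_map v (y - w)"
        using duality_map_self[of v] unfolding v_def[symmetric]
        by (subst (asm) (2) v_def) (simp add: blinfun.bilinear_simps)
      then show ?thesis using lyapunov_nonneg[of w v] by (simp add: lyapunov_def)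
    qed
    finally show ?thesis using t by (simp add: v_def)
  qed
  then show "\<forall>\<^sub>F t in at_right 0. f (y - w) \<le> duality_map (w + t *\<^sub>R (y - w)) (y - w)"
    by (auto simp: eventually_at intro!: exI[of _ 1])
qed auto

lemma bij_duality_map: "bij (duality_map :: 'a \<Rightarrow> _)"
proof (rule bijI)
  show "inj (duality_map :: 'a \<Rightarrow> _)"
  proof (rule injI)
    fix x y :: 'a assume "duality_map x = duality_map y"
    then show "x = y"
      using duality_map_expansive[of x y] convexity_constant_pos by (simp add: mult_le_0_iff)
  qed
  show "surj (duality_map :: 'a \<Rightarrow> _)"
    unfolding surj_def
  proof
    fix f :: "'a \<Rightarrow>\<^sub>L real"
    obtain w where "\<And>y. y \<in> UNIV \<Longrightarrow> (norm w)\<^sup>2 - 2 * f w \<le> (norm y)\<^sup>2 - 2 * f y"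
      using quadratic_minimizer_exists[of UNIV f] by auto
    from quadratic_minimizer_variational[OF _ _ _ this, of UNIV "w + _"]
    have le: "f v \<le> duality_map w v" for v by simp
    have "duality_map w = f"
    proof (rule blinfun_eqI)
      fix v show "duality_map w v = f v" using le[of v] le[of "- v"] by (simp add: blinfun.bilinear_simps)
    qed
    then show "\<exists>x. f = duality_map x" by blast
  qed
qed

lemma duality_map_inv [simp]: "duality_map (duality_map_inv f) = f" for f :: "'a \<Rightarrow>\<^sub>L real"
  using bij_duality_map by (simp add: bij_is_surj surj_f_inv_f)

lemma generalized_projection_exists:
  fixes D :: "'a set" and x :: 'a
  assumes "D \<noteq> {}" "closed D" "convex D"
  shows "generalized_projection D x \<in> D"
    and "\<And>y. y \<in> D \<Longrightarrow> lyapunov (generalized_projection D x) x \<le> lyapunov y x"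
proof -
  obtain w where w: "w \<in> D" "\<And>y. y \<in> D \<Longrightarrow> lyapunov w x \<le> lyapunov y x"
  proof (rule quadratic_minimizer_exists[OF assms, of "duality_map x"])
    fix w assume w: "w \<in> D" "\<And>y. y \<in> D \<Longrightarrow> (norm w)\<^sup>2 - 2 * duality_map x w \<le> (norm y)\<^sup>2 - 2 * duality_map x y"
    have "lyapunov w x \<le> lyapunov y x" if "y \<in> D" for y
      using w(2)[OF that] by (simp add: lyapunov_def)
    with w(1) that show thesis by blast
  qed
  have "is_arg_min (\<lambda>y. lyapunov y x) (\<lambda>y. y \<in> D) (generalized_projection D x)"
    unfolding generalized_projection_def by (rule is_arg_min_arg_min_on) (use w in auto)
  then show "generalized_projection D x \<in> D"
    and "\<And>y. y \<in> D \<Longrightarrow> lyapunov (generalized_projection D x) x \<le> lyapunov y x"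
    by (auto simp: is_arg_min_linorder)
qed

lemma minimizer_variational:
  fixes D :: "'a set" and x :: 'a
  assumes "convex D" "w \<in> D" "y \<in> D" "\<And>y. y \<in> D \<Longrightarrow> lyapunov w x \<le> lyapunov y x"
  shows "(duality_map x - duality_map w) (y - w) \<le> 0"
  using quadratic_minimizer_variational[OF assms(1-3), of "duality_map x"] assms(4)
  by (simp add: lyapunov_def blinfun.bilinear_simps)

lemma minimizer_three_point:
  fixes D :: "'a set" and x :: 'a
  assumes "convex D" "w \<in> D" "y \<in> D" "\<And>y. y \<in> D \<Longrightarrow> lyapunov w x \<le> lyapunov y x"
  shows "lyapunov y w + lyapunov w x \<le> lyapunov y x"
  using minimizer_variational[OF assms] lyapunov_three_point[of y x w]
  by (simp add: blinfun.bilinear_simps)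

text \<open>The variational argument lives on the larger convex set \<open>B\<close>. At the end
  \<open>D\<close> is \<open>F\<close> and \<open>B\<close> is the intersection of all
  \<open>Cs n\<close>.\<close>

lemma generalized_projection_eqI:
  fixes D B :: "'a set" and x :: 'a
  assumes "convex B" "D \<subseteq> B" "w \<in> D" "\<And>y. y \<in> B \<Longrightarrow> lyapunov w x \<le> lyapunov y x"
  shows "generalized_projection D x = w"
proof -
  have unique: "v = w" if v: "v \<in> D" "\<And>y. y \<in> D \<Longrightarrow> lyapunov v x \<le> lyapunov y x" for v
  proof -
    have "lyapunov v w + lyapunov w x \<le> lyapunov v x"
      using assms v by (intro minimizer_three_point[of B]) auto
    also have "\<dots> \<le> lyapunov w x" using assms v by auto
    finally have "2 * convexity_constant * (norm (v - w))\<^sup>2 \<le> 0" using lyapunov_ge[of v w] by simp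
    then show ?thesis using convexity_constant_pos by (simp add: mult_le_0_iff)
  qed
  have "is_arg_min (\<lambda>y. lyapunov y x) (\<lambda>y. y \<in> D) (generalized_projection D x)"
    unfolding generalized_projection_def by (rule is_arg_min_arg_min_on) (use assms in auto)
  then show ?thesis by (intro unique) (auto simp: is_arg_min_linorder)
qed

text \<open>The points of least norm of the finite intersections form a Cauchy net; this replaces weak
  compactness of bounded closed convex sets.\<close>

lemma bounded_convex_fip:
  fixes G :: "'b \<Rightarrow> 'a set"
  assumes G: "\<And>i. i \<in> I \<Longrightarrow> closed (G i)" "\<And>i. i \<in> I \<Longrightarrow> convex (G i)"
    and B: "closed B" "convex B" "bounded B"
    and fip: "\<And>J. finite J \<Longrightarrow> J \<subseteq> I \<Longrightarrow> B \<inter> (\<Inter>i\<in>J. G i) \<noteq> {}"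
  shows "B \<inter> (\<Inter>i\<in>I. G i) \<noteq> {}"
proof -
  define Fin where "Fin = {J. finite J \<and> J \<subseteq> I}"
  define H where "H = (\<lambda>J. B \<inter> (\<Inter>i\<in>J. G i))"
  have H: "H J \<noteq> {}" "closed (H J)" "convex (H J)" if "J \<in> Fin" for J
  proof -
    have J: "finite J" "J \<subseteq> I" using that by (auto simp: Fin_def)
    then show "H J \<noteq> {}" unfolding H_def by (rule fip)
    show "closed (H J)" unfolding H_def using J G(1) B(1) by (intro closed_Int closed_INT) auto
    show "convex (H J)" unfolding H_def using J G(2) B(2) by (intro convex_Int convex_INT) auto
  qed
  define p where "p = (\<lambda>J. generalized_projection (H J) 0)"
  define m where "m = (\<lambda>J. (norm (p J))\<^sup>2)"
  have ly0: "lyapunov y 0 = (norm y)\<^sup>2" for y :: 'a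
    by (simp add: lyapunov_def)
  have p: "p J \<in> H J" "\<And>y. y \<in> H J \<Longrightarrow> lyapunov (p J) 0 \<le> lyapunov y 0" if "J \<in> Fin" for J
    using generalized_projection_exists[OF H[OF that], where x = 0] by (auto simp: p_def)
  \<comment> \<open>\<open>p K\<close> competes in the larger set \<open>H J\<close>, so the
    three-point inequality turns the growth of the least squared norm into a bound on the
    distance.\<close>
  have step: "2 * convexity_constant * (norm (p K - p J))\<^sup>2 \<le> m K - m J"
    if "J \<subseteq> K" "J \<in> Fin" "K \<in> Fin" for J K
  proof -
    have "H K \<subseteq> H J" using that by (auto simp: H_def)
    then have "lyapunov (p K) (p J) + lyapunov (p J) 0 \<le> lyapunov (p K) 0"
      using p that H by (intro minimizer_three_point[of "H J"]) auto
    then show ?thesis using lyapunov_ge[of "p K" "p J"] by (simp add: ly0 m_def)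
  qed
  have mono: "m J \<le> m K" if "J \<subseteq> K" "J \<in> Fin" "K \<in> Fin" for J K
  proof -
    have "0 \<le> 2 * convexity_constant * (norm (p K - p J))\<^sup>2"
      using convexity_constant_pos by simp
    then show ?thesis using step[OF that] by linarith
  qed
  obtain R where R: "\<And>x. x \<in> B \<Longrightarrow> norm x \<le> R" using B(3) bounded_iff by blast
  have "m J \<le> R\<^sup>2" if "J \<in> Fin" for J
    using p(1)[OF that] R by (auto simp: m_def H_def power_mono)
  then have bdd: "bdd_above (m ` Fin)" by (intro bdd_aboveI[of _ "R\<^sup>2"]) auto
  define s where "s = Sup (m ` Fin)"
  have ms: "m J \<le> s" if "J \<in> Fin" for J unfolding s_def by (rule cSup_upper) (use that bdd in auto)
  have "{} \<in> Fin" by (simp add: Fin_def)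
  have "\<exists>J\<in>Fin. s - inverse (real (Suc n)) < m J" for n
  proof -
    have "\<exists>r\<in>m ` Fin. s - inverse (real (Suc n)) < r"
      by (rule less_cSupD) (use \<open>{} \<in> Fin\<close> in \<open>auto simp flip: s_def\<close>)
    then show ?thesis by blast
  qed
  then obtain J where J: "\<And>n. J n \<in> Fin" "\<And>n. s - inverse (real (Suc n)) < m (J n)" by metis
  \<comment> \<open>Unions make the index sets increasing, so one gap to the supremum
    \<open>s\<close> controls a whole tail.\<close>
  define K where "K = (\<lambda>n. \<Union>i\<le>n. J i)"
  have K: "K n \<in> Fin" for n using J(1) by (auto simp: K_def Fin_def)
  have Kmono: "K i \<subseteq> K j" if "i \<le> j" for i j using that by (force simp: K_def)
  have Ks: "s - inverse (real (Suc n)) < m (K n)" for n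
  proof -
    have "J n \<subseteq> K n" by (auto simp: K_def)
    then show ?thesis using J(2)[of n] mono[OF _ J(1) K, of n n] by linarith
  qed
  have close: "(norm (p L - p (K n)))\<^sup>2 \<le> inverse (real (Suc n)) / (2 * convexity_constant)"
    if "K n \<subseteq> L" "L \<in> Fin" for L n
  proof -
    have "2 * convexity_constant * (norm (p L - p (K n)))\<^sup>2 \<le> inverse (real (Suc n))"
      using step[OF that(1) K that(2)] ms[OF that(2)] Ks[of n] by linarith
    then show ?thesis using convexity_constant_pos by (simp only: pos_le_divide_eq mult_ac mult_pos_pos zero_less_numeral)
  qed
  define v where "v = (\<lambda>n. p (K n))"
  have "Cauchy v"
    unfolding Cauchy_altdef2
  proof (intro allI impI)
    fix e :: real assume "e > 0"
    then have "2 * convexity_constant * e\<^sup>2 > 0" using convexity_constant_pos by simp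
    then obtain N where N: "inverse (real (Suc N)) < 2 * convexity_constant * e\<^sup>2"
      using reals_Archimedean by blast
    have "dist (v n) (v N) < e" if "n \<ge> N" for n
    proof -
      have "(norm (v n - v N))\<^sup>2 < e\<^sup>2"
      proof -
        have "inverse (real (Suc N)) < e\<^sup>2 * (2 * convexity_constant)"
          using N by (simp only: mult_ac)
        then have "inverse (real (Suc N)) / (2 * convexity_constant) < e\<^sup>2"
          using convexity_constant_pos by (subst pos_divide_less_eq) simp_all
        with close[OF Kmono[OF that] K] show ?thesis unfolding v_def by (rule order.strict_trans1)
      qed
      then show ?thesis using \<open>e > 0\<close> by (simp add: dist_norm power2_less_imp_less)
    qed
    then show "\<exists>N. \<forall>n\<ge>N. dist (v n) (v N) < e" by blast
  qed
  then obtain w where w: "v \<longlonglongrightarrow> w" using Cauchy_convergent_iff convergent_def by blast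
  have "v n \<in> B" for n using p(1)[OF K[of n]] by (simp add: v_def H_def)
  then have "w \<in> B" using closed_sequentially[OF B(1) _ w] by blast
  moreover have "w \<in> G i" if "i \<in> I" for i
  proof -
    \<comment> \<open>Inserting \<open>i\<close> can raise \<open>m\<close> only by the remaining
      gap to \<open>s\<close>. Hence \<open>u n\<close>, which lies in \<open>G i\<close>, has the
      same limit as \<open>v n\<close>.\<close>
    define u where "u = (\<lambda>n. p (insert i (K n)))"
    have L: "insert i (K n) \<in> Fin" for n using K[of n] that by (simp add: Fin_def)
    have "(\<lambda>n. (norm (u n - v n))\<^sup>2) \<longlonglongrightarrow> 0"
    proof (rule tendsto_sandwich[OF _ _ tendsto_const])
      show "(\<lambda>n. inverse (real (Suc n)) / (2 * convexity_constant)) \<longlonglongrightarrow> 0"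
        by (rule tendsto_divide_zero[OF LIMSEQ_inverse_real_of_nat])
      show "\<forall>\<^sub>F n in sequentially. (norm (u n - v n))\<^sup>2 \<le> inverse (real (Suc n)) / (2 * convexity_constant)"
        unfolding u_def v_def by (rule always_eventually) (use close[OF subset_insertI L] in blast)
    qed simp
    then have "(\<lambda>n. u n - v n) \<longlonglongrightarrow> 0" by (simp add: tendsto_norm_zero_iff)
    from tendsto_add[OF this w] have "u \<longlonglongrightarrow> w" by simp
    moreover have "u n \<in> G i" for n using p(1)[OF L[of n]] by (simp add: u_def H_def)
    ultimately show ?thesis using closed_sequentially[OF G(1)[OF that], of u w] by blast
  qed
  ultimately show ?thesis by blast
qed

end

section \<open>Monotone equilibrium problems and their resolvents\<close>

text \<open>Pinning the coordinates outside \<open>I\<close> to 0 makes the simplex a closed slice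
  of a product of compact sets, so Tychonoff's theorem applies in the full function type.\<close>

lemma compact_simplex:
  assumes "finite I"
  shows "compact {l :: 'i \<Rightarrow> real. (\<forall>i. l i \<in> (if i \<in> I then {0..1} else {0})) \<and> (\<Sum>i\<in>I. l i) = 1}"
proof -
  have "compactin (product_topology (\<lambda>i::'i. euclidean) UNIV) (PiE UNIV (\<lambda>i. if i \<in> I then {0..1::real} else {0}))"
    by (simp add: compactin_PiE)
  then have "compact (PiE UNIV (\<lambda>i. if i \<in> I then {0..1::real} else {0}))"
    by (simp add: euclidean_product_topology)
  moreover have "closed {l :: 'i \<Rightarrow> real. (\<Sum>i\<in>I. l i) = 1}"
    by (intro closed_Collect_eq continuous_on_sum continuous_on_product_coordinates continuous_on_const)
  ultimately have "compact (PiE UNIV (\<lambda>i. if i \<in> I then {0..1::real} else {0}) \<inter> {l. (\<Sum>i\<in>I. l i) = 1})"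
    by (rule compact_Int_closed)
  then show ?thesis by (simp add: PiE_UNIV_domain Pi_def Int_def)
qed

text \<open>A quadratic expansion whose linear coefficient is the derivative of the squared positive
  part; it supplies the first-order condition of the game by a finite step.\<close>

lemma positive_part_square_le:
  fixes s h :: real
  shows "(max 0 (s + h))\<^sup>2 \<le> (max 0 s)\<^sup>2 + 2 * max 0 s * h + h\<^sup>2"
proof -
  have "\<bar>max 0 (s + h)\<bar> \<le> \<bar>max 0 s + h\<bar>" by (auto simp: max_def)
  then have "(max 0 (s + h))\<^sup>2 \<le> (max 0 s + h)\<^sup>2" using abs_le_square_iff by blast
  then show ?thesis by (simp add: power2_sum)
qed

text \<open>A minimizer of the squared length of the positive part of \<open>a l\<close> over the simplex works: if
  the positive part \<open>\<mu>\<close> were nonzero, then testing the first-order condition with the normalized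
  \<open>\<mu>\<close> contradicts \<open>\<mu>\<^sup>T a \<mu> \<le> 0\<close>.\<close>

lemma skew_matrix_game_value:
  fixes a :: "'i \<Rightarrow> 'i \<Rightarrow> real"
  assumes I: "finite I" "I \<noteq> {}"
    and a: "\<And>i j. i \<in> I \<Longrightarrow> j \<in> I \<Longrightarrow> a i j + a j i \<le> 0"
  obtains l where "\<And>i. i \<in> I \<Longrightarrow> 0 \<le> l i" "(\<Sum>i\<in>I. l i) = 1"
    "\<And>i. i \<in> I \<Longrightarrow> (\<Sum>j\<in>I. l j * a i j) \<le> 0"
proof -
  define \<Delta> where "\<Delta> = {l :: 'i \<Rightarrow> real. (\<forall>i. l i \<in> (if i \<in> I then {0..1} else {0})) \<and> (\<Sum>i\<in>I. l i) = 1}"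
  define T where "T = (\<lambda>l i. \<Sum>j\<in>I. l j * a i j)"
  define \<Phi> where "\<Phi> = (\<lambda>l. \<Sum>i\<in>I. (max 0 (T l i))\<^sup>2)"
  have \<Delta>I: "l \<in> \<Delta>" if "\<And>i. i \<in> I \<Longrightarrow> 0 \<le> l i" "\<And>i. i \<notin> I \<Longrightarrow> l i = 0" "(\<Sum>i\<in>I. l i) = 1" for l
  proof -
    have "l i \<le> 1" if "i \<in> I" for i
      using member_le_sum[of i I l] that \<open>\<And>i. i \<in> I \<Longrightarrow> 0 \<le> l i\<close> I \<open>(\<Sum>i\<in>I. l i) = 1\<close> by auto
    then show ?thesis using that by (auto simp: \<Delta>_def)
  qed
  have \<Delta>D: "i \<in> I \<Longrightarrow> 0 \<le> v i" "i \<notin> I \<Longrightarrow> v i = 0" "(\<Sum>i\<in>I. v i) = 1" if "v \<in> \<Delta>" for v i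
  proof -
    have "v i \<in> (if i \<in> I then {0..1} else {0})" using that by (simp add: \<Delta>_def)
    then show "i \<in> I \<Longrightarrow> 0 \<le> v i" "i \<notin> I \<Longrightarrow> v i = 0" by auto
    show "(\<Sum>i\<in>I. v i) = 1" using that by (simp add: \<Delta>_def)
  qed
  obtain i0 where "i0 \<in> I" using I by blast
  then have "(\<lambda>i. if i = i0 then 1 else 0) \<in> \<Delta>" using I by (intro \<Delta>I) auto
  then have "\<Delta> \<noteq> {}" by blast
  moreover have "compact \<Delta>" unfolding \<Delta>_def by (rule compact_simplex[OF I(1)])
  moreover have "continuous_on UNIV \<Phi>"
    unfolding \<Phi>_def T_def
    by (intro continuous_on_sum continuous_on_power continuous_on_max continuous_on_mult
        continuous_on_product_coordinates continuous_on_const)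
  then have "continuous_on \<Delta> \<Phi>" by (rule continuous_on_subset) simp
  ultimately obtain l where l: "l \<in> \<Delta>" "\<And>v. v \<in> \<Delta> \<Longrightarrow> \<Phi> l \<le> \<Phi> v"
    using continuous_attains_inf[of \<Delta> \<Phi>] by blast
  define \<mu> where "\<mu> = (\<lambda>i. if i \<in> I then max 0 (T l i) else 0)"
  have first_order: "0 \<le> (\<Sum>i\<in>I. \<mu> i * (T v i - T l i))" if v: "v \<in> \<Delta>" for v
  proof (rule ccontr)
    define p q where "p = (\<Sum>i\<in>I. \<mu> i * (T v i - T l i))" and "q = (\<Sum>i\<in>I. (T v i - T l i)\<^sup>2)"
    assume "\<not> 0 \<le> (\<Sum>i\<in>I. \<mu> i * (T v i - T l i))"
    then have p: "p < 0" by (simp add: p_def)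
    have q: "0 \<le> q" by (simp add: q_def sum_nonneg)
    \<comment> \<open>Minimality will give \<open>0 \<le> 2 * p + t * q\<close>. This
      \<open>t\<close> keeps \<open>t * q\<close> at most \<open>- p\<close>, so the right-hand side
      is at most \<open>p\<close>, which is negative; the 1 guards against
      \<open>q = 0\<close>.\<close>
    define t where "t = min 1 (- p / (q + 1))"
    have t: "0 < t" "t \<le> 1" "t \<le> - p / (q + 1)"
      using p q by (auto simp: t_def divide_neg_pos)
    then have tq: "t * (q + 1) \<le> - p" using q by (simp only: pos_le_divide_eq)
    define w where "w = (\<lambda>i. (1 - t) * l i + t * v i)"
    have "w \<in> \<Delta>"
    proof (rule \<Delta>I)
      show "(\<Sum>i\<in>I. w i) = 1"
        using \<Delta>D(3)[OF l(1)] \<Delta>D(3)[OF v] by (simp add: w_def sum.distrib flip: sum_distrib_left)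
      show "0 \<le> w i" if "i \<in> I" for i
        using \<Delta>D(1)[OF l(1) that] \<Delta>D(1)[OF v that] t by (simp add: w_def)
      show "w i = 0" if "i \<notin> I" for i
        using \<Delta>D(2)[OF l(1) that] \<Delta>D(2)[OF v that] by (simp add: w_def)
    qed
    then have "\<Phi> l \<le> \<Phi> w" by (rule l(2))
    also have "\<Phi> w = (\<Sum>i\<in>I. (max 0 (T l i + t * (T v i - T l i)))\<^sup>2)"
    proof -
      have "T w i = (1 - t) * T l i + t * T v i" for i
        by (simp add: T_def w_def distrib_right sum.distrib sum_distrib_left mult.assoc)
      then have "T w i = T l i + t * (T v i - T l i)" for i by (simp add: algebra_simps)
      then show ?thesis by (simp add: \<Phi>_def)
    qed
    also have "\<dots> \<le> (\<Sum>i\<in>I. (max 0 (T l i))\<^sup>2 + 2 * t * (\<mu> i * (T v i - T l i)) + t\<^sup>2 * (T v i - T l i)\<^sup>2)"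
    proof (rule sum_mono)
      fix i assume "i \<in> I"
      then show "(max 0 (T l i + t * (T v i - T l i)))\<^sup>2
          \<le> (max 0 (T l i))\<^sup>2 + 2 * t * (\<mu> i * (T v i - T l i)) + t\<^sup>2 * (T v i - T l i)\<^sup>2"
        using positive_part_square_le[of "T l i" "t * (T v i - T l i)"]
        by (simp add: \<mu>_def power_mult_distrib mult_ac)
    qed
    also have "\<dots> = \<Phi> l + 2 * t * p + t\<^sup>2 * q"
      by (simp add: \<Phi>_def p_def q_def sum.distrib sum_distrib_left)
    finally have "0 \<le> t * (2 * p + t * q)" by (simp add: power2_eq_square algebra_simps)
    then have "0 \<le> 2 * p + t * q" using t by (simp add: zero_le_mult_iff)
    moreover have "t * q \<le> t * (q + 1)" using t by simp
    ultimately show False using tq p by linarith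
  qed
  have \<mu>0: "0 \<le> \<mu> i" for i by (simp add: \<mu>_def)
  have "\<mu> i = 0" if i: "i \<in> I" for i
  proof (rule ccontr)
    assume "\<mu> i \<noteq> 0"
    define \<sigma> where "\<sigma> = (\<Sum>i\<in>I. \<mu> i)"
    have \<sigma>: "0 < \<sigma>"
      unfolding \<sigma>_def using I i \<mu>0 \<open>\<mu> i \<noteq> 0\<close> by (intro sum_pos2[of I i]) (auto simp: less_le)
    have "(\<lambda>i. \<mu> i / \<sigma>) \<in> \<Delta>"
      using \<sigma> \<mu>0 by (intro \<Delta>I) (auto simp: \<mu>_def \<sigma>_def simp flip: sum_divide_distrib)
    from first_order[OF this]
    have "(\<Sum>i\<in>I. \<mu> i * T l i) \<le> (\<Sum>i\<in>I. \<mu> i * T (\<lambda>i. \<mu> i / \<sigma>) i)"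
      by (simp add: right_diff_distrib sum_subtractf)
    also have "\<dots> = (\<Sum>i\<in>I. \<Sum>j\<in>I. \<mu> i * \<mu> j * a i j) / \<sigma>"
      by (simp add: T_def sum_distrib_left sum_divide_distrib mult_ac)
    also have "\<dots> \<le> 0"
    proof -
      \<comment> \<open>Adding the transposed sum exposes the symmetric part of
        \<open>a\<close>.\<close>
      have "2 * (\<Sum>i\<in>I. \<Sum>j\<in>I. \<mu> i * \<mu> j * a i j)
          = (\<Sum>i\<in>I. \<Sum>j\<in>I. \<mu> i * \<mu> j * a i j) + (\<Sum>j\<in>I. \<Sum>i\<in>I. \<mu> i * \<mu> j * a i j)"
        by (subst (3) sum.swap) simp
      also have "\<dots> = (\<Sum>i\<in>I. \<Sum>j\<in>I. \<mu> i * \<mu> j * (a i j + a j i))"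
        by (simp add: sum.distrib algebra_simps)
      also have "\<dots> \<le> 0"
        using a \<mu>0 by (intro sum_nonpos mult_nonneg_nonpos) auto
      finally show ?thesis using \<sigma> by (simp add: divide_nonpos_pos)
    qed
    finally have "(\<Sum>i\<in>I. \<mu> i * T l i) \<le> 0" .
    \<comment> \<open>Where \<open>\<mu> i\<close> is nonzero it equals \<open>T l i\<close>, so
      this is a sum of squares.\<close>
    moreover have "0 < (\<Sum>i\<in>I. \<mu> i * T l i)"
      using I i \<open>\<mu> i \<noteq> 0\<close> by (intro sum_pos2[of I i]) (auto simp: \<mu>_def max_def split: if_splits)
    ultimately show False by simp
  qed
  then have "T l i \<le> 0" if "i \<in> I" for i using that by (force simp: \<mu>_def max_def split: if_splits)
  then show ?thesis using l(1) that[of l] \<Delta>D[OF l(1)] by (auto simp: T_def)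
qed

text \<open>The two semicontinuity conditions are kept in epsilon-delta form, which is easily
  preserved when a continuous term is added and when \<open>C\<close> is cut down to a ball.\<close>

locale equilibrium_bifunction =
  fixes C :: "'a::real_normed_vector set" and f :: "'a \<Rightarrow> 'a \<Rightarrow> real"
  assumes refl: "v \<in> C \<Longrightarrow> f v v = 0"
    and monotone: "v \<in> C \<Longrightarrow> w \<in> C \<Longrightarrow> f v w + f w v \<le> 0"
    and hemicontinuous: "v \<in> C \<Longrightarrow> w \<in> C \<Longrightarrow> q \<in> C \<Longrightarrow> 0 < e \<Longrightarrow>
      \<exists>\<delta>>0. \<forall>t. 0 < t \<and> t < \<delta> \<longrightarrow> f (t *\<^sub>R q + (1 - t) *\<^sub>R v) w < f v w + e"
    and convex_right: "v \<in> C \<Longrightarrow> convex_on C (f v)"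
    and lsc_right: "v \<in> C \<Longrightarrow> w \<in> C \<Longrightarrow> 0 < e \<Longrightarrow> \<exists>\<delta>>0. \<forall>q\<in>C. dist q w < \<delta> \<longrightarrow> f v w - e < f v q"
begin

lemma lsc_right_limit:
  assumes "v \<in> C" "w \<in> C" "\<And>n. q n \<in> C" "q \<longlonglongrightarrow> w" "\<And>n. f v (q n) \<le> s n" "s \<longlonglongrightarrow> s0"
  shows "f v w \<le> s0"
proof (rule field_le_epsilon)
  fix e :: real assume "e > 0"
  obtain \<delta> where \<delta>: "\<delta> > 0" "\<And>q. q \<in> C \<Longrightarrow> dist q w < \<delta> \<Longrightarrow> f v w - e / 2 < f v q"
    using lsc_right[OF assms(1,2), of "e / 2"] \<open>e > 0\<close> by auto
  have "\<forall>\<^sub>F n in sequentially. dist (q n) w < \<delta>" using assms(4) \<delta>(1) by (rule tendstoD)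
  moreover have "\<forall>\<^sub>F n in sequentially. dist (s n) s0 < e / 2"
    using assms(6) \<open>e > 0\<close> by (intro tendstoD) auto
  ultimately have "\<forall>\<^sub>F n in sequentially. f v w \<le> s0 + e"
  proof eventually_elim
    case (elim n)
    show ?case using \<delta>(2)[OF assms(3)[of n] elim(1)] assms(5)[of n] elim(2)
      unfolding dist_real_def by linarith
  qed
  then show "f v w \<le> s0 + e" by simp
qed

lemma closed_sublevel:
  assumes "closed C" "v \<in> C"
  shows "closed {w \<in> C. f v w \<le> 0}"
  unfolding closed_sequential_limits
proof (intro allI impI)
  fix q w assume q: "(\<forall>n. q n \<in> {w \<in> C. f v w \<le> 0}) \<and> q \<longlonglongrightarrow> w"
  then have "w \<in> C" using closed_sequentially[OF assms(1), of q w] by auto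
  moreover have "f v w \<le> 0"
    by (rule lsc_right_limit[OF assms(2) \<open>w \<in> C\<close>, of q "\<lambda>_. 0"]) (use q in auto)
  ultimately show "w \<in> {w \<in> C. f v w \<le> 0}" by blast
qed

lemma convex_sublevel:
  assumes "convex C" "v \<in> C"
  shows "convex {w \<in> C. f v w \<le> 0}"
  unfolding convex_def
proof (intro ballI allI impI CollectI conjI)
  fix x y and s t :: real
  assume *: "x \<in> {w \<in> C. f v w \<le> 0}" "y \<in> {w \<in> C. f v w \<le> 0}" "0 \<le> s" "0 \<le> t" "s + t = 1"
  then show "s *\<^sub>R x + t *\<^sub>R y \<in> C" using convexD[OF assms(1)] by simp
  have "f v (s *\<^sub>R x + t *\<^sub>R y) \<le> s * f v x + t * f v y"
    using convex_right[OF assms(2)] * by (simp add: convex_on_def)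
  also have "\<dots> \<le> 0" using * by (intro add_nonpos_nonpos mult_nonneg_nonpos) auto
  finally show "f v (s *\<^sub>R x + t *\<^sub>R y) \<le> 0" .
qed

text \<open>If \<open>f w y\<close> were negative, hemicontinuity would keep \<open>f v y\<close>
  negative at a point \<open>v\<close> of the segment close to \<open>w\<close>. Since
  \<open>f v w\<close> is nonpositive, convexity would make \<open>f v v\<close> negative, against
  \<open>refl\<close>.\<close>

lemma minty:
  assumes "convex C" "w \<in> C" "\<And>y. y \<in> C \<Longrightarrow> f y w \<le> 0" "y \<in> C"
  shows "0 \<le> f w y"
proof (rule ccontr)
  assume neg: "\<not> 0 \<le> f w y"
  then obtain \<delta> where \<delta>: "\<delta> > 0" "\<And>t. 0 < t \<Longrightarrow> t < \<delta> \<Longrightarrow> f (t *\<^sub>R y + (1 - t) *\<^sub>R w) y < f w y + - f w y"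
    using hemicontinuous[OF assms(2,4,4), of "- f w y"] by auto
  define t where "t = min (1 / 2) (\<delta> / 2)"
  have t: "0 < t" "t < 1" "t < \<delta>" using \<delta>(1) by (auto simp: t_def)
  define v where "v = (1 - t) *\<^sub>R w + t *\<^sub>R y"
  have v: "v \<in> C" unfolding v_def using convexD[OF assms(1,2,4), of "1 - t" t] t by simp
  have "0 = f v v" using refl[OF v] by simp
  also have "\<dots> \<le> (1 - t) * f v w + t * f v y"
    using convex_onD[OF convex_right[OF v], of t w y] t assms(2,4) unfolding v_def by simp
  also have "\<dots> < 0"
  proof -
    have "f v y < 0" using \<delta>(2)[of t] t by (simp add: v_def add.commute)
    then have "t * f v y < 0" using t by (simp add: mult_pos_neg)
    moreover have "(1 - t) * f v w \<le> 0" using t assms(3)[OF v] by (simp add: mult_nonneg_nonpos)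
    ultimately show ?thesis by simp
  qed
  finally show False by simp
qed

lemma subset:
  assumes "D \<subseteq> C" "convex D"
  shows "equilibrium_bifunction D f"
proof
  fix v w q e assume *: "v \<in> D" "w \<in> D"
  then have vw: "v \<in> C" "w \<in> C" using assms by auto
  show "f v w + f w v \<le> 0" by (rule monotone[OF vw])
  show "\<exists>\<delta>>0. \<forall>t. 0 < t \<and> t < \<delta> \<longrightarrow> f (t *\<^sub>R q + (1 - t) *\<^sub>R v) w < f v w + e" if "q \<in> D" "0 < e"
    using hemicontinuous[OF vw, of q e] that assms by auto
  show "\<exists>\<delta>>0. \<forall>q\<in>D. dist q w < \<delta> \<longrightarrow> f v w - e < f v q" if "0 < e"
    using lsc_right[OF vw that] assms by blast
qed (use assms refl convex_right convex_on_subset in blast)+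

end

context smooth_two_convex_space
begin

text \<open>For finite \<open>J\<close>, monotonicity is the sign condition of the game with matrix
  \<open>h i j\<close>, and Jensen's inequality bounds \<open>h i w\<close> at the weighted mean
  \<open>w\<close> by the row sum of the game.\<close>

lemma minty_solution_bounded:
  fixes B :: "'a set"
  assumes "equilibrium_bifunction B h" "B \<noteq> {}" "closed B" "convex B" "bounded B"
  obtains w where "w \<in> B" "\<And>y. y \<in> B \<Longrightarrow> h y w \<le> 0"
proof -
  interpret equilibrium_bifunction B h by fact
  have "B \<inter> (\<Inter>y\<in>B. {w \<in> B. h y w \<le> 0}) \<noteq> {}"
  proof (rule bounded_convex_fip)
    fix J assume J: "finite J" "J \<subseteq> B"
    show "B \<inter> (\<Inter>y\<in>J. {w \<in> B. h y w \<le> 0}) \<noteq> {}"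
    proof (cases "J = {}")
      case False
      obtain l where l: "\<And>i. i \<in> J \<Longrightarrow> 0 \<le> l i" "(\<Sum>i\<in>J. l i) = 1"
        "\<And>i. i \<in> J \<Longrightarrow> (\<Sum>j\<in>J. l j * h i j) \<le> 0"
        using skew_matrix_game_value[OF J(1) False, of h] monotone J(2) by blast
      define w where "w = (\<Sum>i\<in>J. l i *\<^sub>R i)"
      have "w \<in> B" unfolding w_def using J l assms(4) by (intro convex_sum) auto
      moreover have "h i w \<le> 0" if "i \<in> J" for i
      proof -
        have "h i w \<le> (\<Sum>j\<in>J. l j * h i j)"
          unfolding w_def using J l that False by (intro convex_on_sum[OF _ _ convex_right]) auto
        then show ?thesis using l(3)[OF that] by simp
      qed
      ultimately show ?thesis by blast
    qed (use assms in simp)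
  qed (use assms closed_sublevel convex_sublevel in auto)
  then show ?thesis using that by blast
qed

text \<open>Makes the resolvent inequality an equilibrium problem of the same kind: the added term
  is monotone and hemicontinuous because the duality map is monotone and continuous, and it is
  affine in \<open>w\<close>.\<close>

lemma regularized_bifunction:
  fixes C :: "'a set" and g :: "'a \<Rightarrow>\<^sub>L real"
  assumes "equilibrium_bifunction C f" "0 < r" "convex C"
  shows "equilibrium_bifunction C (\<lambda>v w. f v w + 1 / r * (duality_map v - g) (w - v))"
proof -
  interpret equilibrium_bifunction C f by fact
  show ?thesis
  proof
    fix v w q :: 'a and e :: real assume vw: "v \<in> C" "w \<in> C"
    show "f v w + 1 / r * (duality_map v - g) (w - v) + (f w v + 1 / r * (duality_map w - g) (v - w)) \<le> 0"
    proof -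
      have "0 \<le> (duality_map v - duality_map w) (v - w)"
        by (rule order_trans[OF _ duality_map_strongly_monotone]) (simp add: convexity_constant_pos less_imp_le)
      then have "0 \<le> 1 / r * (duality_map v - duality_map w) (v - w)" using assms(2) by simp
      moreover have "1 / r * (duality_map v - g) (w - v) + 1 / r * (duality_map w - g) (v - w)
          = - (1 / r * (duality_map v - duality_map w) (v - w))"
        by (simp add: blinfun.bilinear_simps algebra_simps diff_divide_distrib add_divide_distrib)
      ultimately show ?thesis using monotone[OF vw] by linarith
    qed
    show "\<exists>\<delta>>0. \<forall>t. 0 < t \<and> t < \<delta> \<longrightarrow>
        f (t *\<^sub>R q + (1 - t) *\<^sub>R v) w
          + 1 / r * (duality_map (t *\<^sub>R q + (1 - t) *\<^sub>R v) - g) (w - (t *\<^sub>R q + (1 - t) *\<^sub>R v))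
        < f v w + 1 / r * (duality_map v - g) (w - v) + e" if qe: "q \<in> C" "0 < e"
    proof -
      define P where "P = (\<lambda>t. 1 / r * (duality_map (t *\<^sub>R q + (1 - t) *\<^sub>R v) - g) (w - (t *\<^sub>R q + (1 - t) *\<^sub>R v)))"
      have "(P \<longlongrightarrow> 1 / r * (duality_map (0 *\<^sub>R q + (1 - 0) *\<^sub>R v) - g) (w - (0 *\<^sub>R q + (1 - 0) *\<^sub>R v))) (at 0)"
        unfolding P_def by (intro tendsto_intros)
      moreover define P0 where "P0 = 1 / r * (duality_map v - g) (w - v)"
      ultimately have "(P \<longlongrightarrow> P0) (at 0)" by simp
      from tendstoD[OF this, of "e / 2"] qe
      obtain d where d: "d > 0" "\<And>t. t \<noteq> 0 \<Longrightarrow> \<bar>t\<bar> < d \<Longrightarrow> dist (P t) P0 < e / 2"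
        by (auto simp: eventually_at)
      obtain d' where d': "d' > 0" "\<And>t. 0 < t \<Longrightarrow> t < d' \<Longrightarrow> f (t *\<^sub>R q + (1 - t) *\<^sub>R v) w < f v w + e / 2"
        using hemicontinuous[OF vw qe(1), of "e / 2"] qe(2) by auto
      have "f (t *\<^sub>R q + (1 - t) *\<^sub>R v) w + P t < f v w + P0 + e"
        if "0 < t" "t < min d d'" for t
      proof -
        have "dist (P t) P0 < e / 2" using d(2)[of t] that by simp
        then have "P t < P0 + e / 2" unfolding dist_real_def by linarith
        moreover have "f (t *\<^sub>R q + (1 - t) *\<^sub>R v) w < f v w + e / 2" using d'(2)[of t] that by simp
        ultimately show ?thesis by linarith
      qed
      then show ?thesis unfolding P_def P0_def using d(1) d'(1) by (intro exI[of _ "min d d'"]) simp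
    qed
    show "\<exists>\<delta>>0. \<forall>q\<in>C. dist q w < \<delta> \<longrightarrow>
        f v w + 1 / r * (duality_map v - g) (w - v) - e < f v q + 1 / r * (duality_map v - g) (q - v)" if e: "0 < e"
    proof -
      define P where "P = (\<lambda>q. 1 / r * (duality_map v - g) (q - v))"
      have "(P \<longlongrightarrow> P w) (nhds w)" unfolding P_def by (intro tendsto_intros filterlim_ident)
      from tendstoD[OF this, of "e / 2"] e
      obtain d where d: "d > 0" "\<And>q. dist q w < d \<Longrightarrow> dist (P q) (P w) < e / 2"
        by (auto simp: eventually_nhds_metric)
      obtain d' where d': "d' > 0" "\<And>q. q \<in> C \<Longrightarrow> dist q w < d' \<Longrightarrow> f v w - e / 2 < f v q"
        using lsc_right[OF vw, of "e / 2"] e by auto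
      have "f v w + P w - e < f v q + P q" if "q \<in> C" "dist q w < min d d'" for q
      proof -
        have "dist (P q) (P w) < e / 2" using d(2)[of q] that by simp
        then have "P w < P q + e / 2" unfolding dist_real_def by linarith
        moreover have "f v w - e / 2 < f v q" using d'(2)[of q] that by simp
        ultimately show ?thesis by linarith
      qed
      then show ?thesis unfolding P_def using d(1) d'(1) by (intro exI[of _ "min d d'"]) simp
    qed
  next
    fix v assume v: "v \<in> C"
    then show "f v v + 1 / r * (duality_map v - g) (v - v) = 0" by (simp add: refl blinfun.bilinear_simps)
    have "convex_on C (\<lambda>w. 1 / r * (duality_map v - g) (w - v))"
      unfolding convex_on_def
    proof (intro conjI assms(3) ballI allI impI)
      fix x y and s t :: real assume "0 \<le> s" "0 \<le> t" "s + t = 1"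
      then have "s *\<^sub>R x + t *\<^sub>R y - v = s *\<^sub>R (x - v) + t *\<^sub>R (y - v)"
        by (simp add: algebra_simps flip: scaleR_add_left)
      then show "1 / r * (duality_map v - g) (s *\<^sub>R x + t *\<^sub>R y - v)
          \<le> s * (1 / r * (duality_map v - g) (x - v)) + t * (1 / r * (duality_map v - g) (y - v))"
        by (simp only: blinfun.add_right blinfun.scaleR_right) (simp add: algebra_simps add_divide_distrib)
    qed
    then show "convex_on C (\<lambda>w. f v w + 1 / r * (duality_map v - g) (w - v))"
      by (intro convex_on_add convex_right v)
  qed
qed

end

context smooth_two_convex_space
begin

text \<open>Solve on \<open>C\<close> cut by a ball. Testing the solution with a fixed
  \<open>y0\<close> bounds its norm, since \<open>norm w\<close> enters quadratically through the
  duality map while \<open>f w y0\<close> grows at most linearly. So the solution lies strictly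
  inside the ball, and convexity along segments extends the inequality to \<open>C\<close>.\<close>

lemma regularized_equilibrium_exists:
  fixes C :: "'a set" and g :: "'a \<Rightarrow>\<^sub>L real"
  assumes f: "equilibrium_bifunction C f" and r: "0 < r"
    and C: "C \<noteq> {}" "closed C" "convex C"
  obtains w where "w \<in> C" "\<And>y. y \<in> C \<Longrightarrow> 0 \<le> f w y + 1 / r * (duality_map w - g) (y - w)"
proof -
  interpret f: equilibrium_bifunction C f by (rule f)
  define h where "h = (\<lambda>v w. f v w + 1 / r * (duality_map v - g) (w - v))"
  interpret h: equilibrium_bifunction C h unfolding h_def by (rule regularized_bifunction[OF f r C(3)])
  obtain y0 where y0: "y0 \<in> C" using C by blast
  obtain \<delta> where \<delta>: "\<delta> > 0" "\<And>q. q \<in> C \<Longrightarrow> dist q y0 < \<delta> \<Longrightarrow> f y0 y0 - 1 < f y0 q"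
    using f.lsc_right[OF y0 y0, of 1] by auto
  \<comment> \<open>Lower semicontinuity gives the bound \<open>- 1\<close> near \<open>y0\<close>.
    A farther \<open>q\<close> is pulled back along the segment to distance
    \<open>\<delta> / 2\<close>, and convexity scales the bound by \<open>1 / t\<close>; hence the
    slope \<open>2 / \<delta>\<close>.\<close>
  have lower: "- 1 - 2 / \<delta> * norm (q - y0) \<le> f y0 q" if q: "q \<in> C" for q
  proof (cases "norm (q - y0) < \<delta>")
    case True
    then have "- 1 < f y0 q" using \<delta>(2)[OF q] f.refl[OF y0] by (simp add: dist_norm)
    moreover have "0 \<le> 2 / \<delta> * norm (q - y0)" using \<delta>(1) by simp
    ultimately show ?thesis by linarith
  next
    case False
    define t where "t = \<delta> / (2 * norm (q - y0))"
    have n: "norm (q - y0) > 0" using False \<delta>(1) by linarith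
    have t: "0 < t" "t \<le> 1" using False \<delta>(1) n by (auto simp: t_def field_simps)
    define v where "v = (1 - t) *\<^sub>R y0 + t *\<^sub>R q"
    have v: "v \<in> C" unfolding v_def using convexD[OF C(3) y0 q, of "1 - t" t] t by simp
    have "v - y0 = t *\<^sub>R (q - y0)" by (simp add: v_def algebra_simps)
    then have "norm (v - y0) = \<delta> / 2" using t n \<delta>(1) by (simp add: t_def)
    then have "- 1 < f y0 v" using \<delta> v f.refl[OF y0] by (simp add: dist_norm)
    also have "f y0 v \<le> t * f y0 q"
      using convex_onD[OF f.convex_right[OF y0], of t y0 q] t y0 q f.refl[OF y0] by (simp add: v_def)
    finally have "- (1 / t) < f y0 q" using t by (simp add: field_simps)
    moreover have "1 / t = 2 / \<delta> * norm (q - y0)" using n \<delta>(1) by (simp add: t_def)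
    ultimately show ?thesis by linarith
  qed
  define p where "p = norm y0"
  \<comment> \<open>The constant and the linear coefficient of the inequality
    \<open>n * n \<le> A0 + B0 * n\<close> for \<open>n = norm w\<close>, obtained after
    multiplication by \<open>r\<close>.\<close>
  define A0 where "A0 = r * (1 + 2 / \<delta> * p) + norm g * p"
  define B0 where "B0 = r * (2 / \<delta>) + p + norm g"
  have nonneg: "0 \<le> p" "0 \<le> A0" "0 \<le> B0" using r \<delta>(1) by (auto simp: p_def A0_def B0_def)
  have coercive: "norm w < A0 + B0 + 1" if w: "w \<in> C" "0 \<le> h w y0" for w
  proof -
    define n where "n = norm w"
    have nw: "norm (w - y0) \<le> n + p" unfolding n_def p_def by (rule norm_triangle_ineq4)
    have "f w y0 \<le> - f y0 w" using f.monotone[OF w(1) y0] by simp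
    also have "\<dots> \<le> 1 + 2 / \<delta> * norm (w - y0)" using lower[OF w(1)] by simp
    also have "\<dots> \<le> 1 + 2 / \<delta> * (n + p)" using nw \<delta>(1) by (simp add: divide_right_mono)
    finally have "0 \<le> 1 + 2 / \<delta> * (n + p) + 1 / r * (duality_map w - g) (y0 - w)"
      using w(2) by (simp add: h_def)
    then have "0 \<le> r * (1 + 2 / \<delta> * (n + p) + 1 / r * (duality_map w - g) (y0 - w))"
      using r by (intro mult_nonneg_nonneg) auto
    also have "\<dots> = r * (1 + 2 / \<delta> * (n + p)) + (duality_map w - g) (y0 - w)"
      using r by (simp add: distrib_left)
    also have "(duality_map w - g) (y0 - w) = duality_map w y0 - n\<^sup>2 + g (w - y0)"
      by (simp add: blinfun.bilinear_simps n_def)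
    also have "duality_map w y0 \<le> n * p" unfolding n_def p_def by (rule duality_map_le)
    also have "g (w - y0) \<le> norm g * norm (w - y0)" using norm_blinfun[of g "w - y0"] by simp
    also have "norm g * norm (w - y0) \<le> norm g * (n + p)" using nw by (simp add: mult_left_mono)
    finally have sq: "n * n \<le> A0 + B0 * n"
      by (simp add: A0_def B0_def power2_eq_square algebra_simps add_divide_distrib)
    show ?thesis
    proof (rule ccontr)
      assume "\<not> norm w < A0 + B0 + 1"
      then have n: "A0 + B0 + 1 \<le> n" by (simp add: n_def)
      then have "1 \<le> n" using nonneg by simp
      have "(A0 + B0 + 1) * n \<le> n * n" using n \<open>1 \<le> n\<close> by (intro mult_right_mono) auto
      moreover have "A0 \<le> A0 * n" using \<open>1 \<le> n\<close> nonneg(2) by (simp add: mult_le_cancel_left1)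
      ultimately show False using sq \<open>1 \<le> n\<close> by (simp add: algebra_simps)
    qed
  qed
  \<comment> \<open>The summand \<open>p\<close> places \<open>y0\<close> in the ball, so that it is
    an admissible test point; the rest exceeds the norm of any solution.\<close>
  define R where "R = A0 + B0 + 1 + p"
  define CR where "CR = C \<inter> cball 0 R"
  have "norm y0 \<le> R" using nonneg by (simp add: R_def p_def)
  then have "y0 \<in> CR" using y0 by (simp add: CR_def)
  moreover have "closed CR" "convex CR" "bounded CR" "CR \<subseteq> C"
    using C by (auto simp: CR_def intro!: closed_Int convex_Int bounded_Int)
  ultimately have CR: "CR \<noteq> {}" "closed CR" "convex CR" "bounded CR" "CR \<subseteq> C" "y0 \<in> CR" by auto
  interpret hR: equilibrium_bifunction CR h by (rule h.subset[OF CR(5,3)])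
  obtain w where w: "w \<in> CR" "\<And>y. y \<in> CR \<Longrightarrow> h y w \<le> 0"
    using minty_solution_bounded[OF hR.equilibrium_bifunction_axioms CR(1-4)] by metis
  have sol: "0 \<le> h w y" if "y \<in> CR" for y by (rule hR.minty[OF CR(3) w that])
  have wC: "w \<in> C" using w(1) CR(5) by blast
  have wR: "norm w < R" using coercive[OF wC sol[OF CR(6)]] nonneg by (simp add: R_def)
  have "0 \<le> h w y" if y: "y \<in> C" for y
  proof -
    \<comment> \<open>Small enough that the point \<open>v\<close> of the segment from
      \<open>w\<close> to \<open>y\<close> stays in the ball, where the inequality is already
      known.\<close>
    define t where "t = min 1 ((R - norm w) / (norm (y - w) + 1))"
    have n1: "norm (y - w) + 1 > 0" by (simp add: add_nonneg_pos)
    have t: "0 < t" "t \<le> 1" "t \<le> (R - norm w) / (norm (y - w) + 1)"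
      using wR n1 by (auto simp: t_def)
    then have "t * (norm (y - w) + 1) \<le> R - norm w" using n1 by (simp only: pos_le_divide_eq)
    then have tn: "norm w + t * norm (y - w) \<le> R" using t by (simp add: algebra_simps)
    define v where "v = (1 - t) *\<^sub>R w + t *\<^sub>R y"
    have "v \<in> C" unfolding v_def using convexD[OF C(3) wC y, of "1 - t" t] t by simp
    moreover have "v = w + t *\<^sub>R (y - w)" by (simp add: v_def algebra_simps)
    then have "norm v \<le> R" using norm_triangle_ineq[of w "t *\<^sub>R (y - w)"] t tn by simp
    ultimately have "v \<in> CR" by (simp add: CR_def)
    then have "0 \<le> h w v" by (rule sol)
    also have "\<dots> \<le> t * h w y"
      using convex_onD[OF h.convex_right[OF wC], of t w y] t wC y h.refl[OF wC] by (simp add: v_def)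
    finally show ?thesis using t by (simp add: zero_le_mult_iff)
  qed
  then show ?thesis using that wC unfolding h_def by blast
qed

text \<open>The \<open>THE\<close> in \<open>resolvent\<close> needs uniqueness: adding the
  inequalities of two solutions, each tested with the other, contradicts strong monotonicity of the
  duality map unless they coincide.\<close>

lemma resolvent_solution:
  fixes C :: "'a set"
  assumes f: "equilibrium_bifunction C f" and r: "0 < r"
    and C: "C \<noteq> {}" "closed C" "convex C"
  shows "resolvent f C r x \<in> C"
    and "\<And>y. y \<in> C \<Longrightarrow> 0 \<le> f (resolvent f C r x) y
           + 1 / r * (duality_map (resolvent f C r x) - duality_map x) (y - resolvent f C r x)"
proof -
  interpret equilibrium_bifunction C f by (rule f)
  define P where "P = (\<lambda>w. w \<in> C \<and> (\<forall>y\<in>C. 0 \<le> f w y + 1 / r * (duality_map w - duality_map x) (y - w)))"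
  have "\<exists>w. P w"
    by (rule regularized_equilibrium_exists[OF f r C, of "duality_map x"]) (auto simp: P_def)
  then obtain w where w: "P w" ..
  have "v = w" if v: "P v" for v
  proof -
    have "0 \<le> f w v + 1 / r * (duality_map w - duality_map x) (v - w)"
      "0 \<le> f v w + 1 / r * (duality_map v - duality_map x) (w - v)" "f w v + f v w \<le> 0"
      using v w monotone unfolding P_def by auto
    then have "0 \<le> 1 / r * ((duality_map w - duality_map x) (v - w) + (duality_map v - duality_map x) (w - v))"
      unfolding distrib_left by linarith
    also have "(duality_map w - duality_map x) (v - w) + (duality_map v - duality_map x) (w - v)
        = - (duality_map v - duality_map w) (v - w)"
      by (simp add: blinfun.bilinear_simps)
    finally have "(duality_map v - duality_map w) (v - w) \<le> 0" using r by (simp add: divide_le_0_iff)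
    then have "2 * convexity_constant * (norm (v - w))\<^sup>2 \<le> 0"
      using duality_map_strongly_monotone[of v w] by linarith
    then show ?thesis using convexity_constant_pos by (simp add: mult_le_0_iff)
  qed
  then have "P (THE w. P w)" by (rule theI[of P, OF w])
  then have "P (resolvent f C r x)" by (simp add: P_def resolvent_def)
  then show "resolvent f C r x \<in> C"
    and "\<And>y. y \<in> C \<Longrightarrow> 0 \<le> f (resolvent f C r x) y
           + 1 / r * (duality_map (resolvent f C r x) - duality_map x) (y - resolvent f C r x)"
    by (auto simp: P_def)
qed

text \<open>As \<open>p\<close> solves the equilibrium problem, monotonicity makes
  \<open>f w p\<close> nonpositive at the resolvent \<open>w\<close>. The pairing in the resolvent
  inequality is then nonnegative, and it is the cross term of the three-point identity.\<close>

lemma lyapunov_resolvent_le: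
  fixes C :: "'a set"
  assumes f: "equilibrium_bifunction C f" and r: "0 < r"
    and C: "C \<noteq> {}" "closed C" "convex C"
    and p: "p \<in> EP f C"
  shows "lyapunov p (resolvent f C r x) \<le> lyapunov p x"
proof -
  interpret equilibrium_bifunction C f by (rule f)
  define w where "w = resolvent f C r x"
  have w: "w \<in> C" "\<And>y. y \<in> C \<Longrightarrow> 0 \<le> f w y + 1 / r * (duality_map w - duality_map x) (y - w)"
    unfolding w_def using resolvent_solution[OF f r C] by auto
  have pC: "p \<in> C" "0 \<le> f p w" using p w(1) by (auto simp: EP_def)
  then have "0 \<le> 1 / r * (duality_map w - duality_map x) (p - w)"
    using w(2)[OF pC(1)] monotone[OF w(1) pC(1)] by linarith
  then have "0 \<le> (duality_map w - duality_map x) (p - w)" using r by (simp add: zero_le_divide_iff)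
  then show ?thesis
    using lyapunov_three_point[of p x w] lyapunov_nonneg[of w x] by (simp add: w_def)
qed

text \<open>The dual step sends \<open>x\<close> to a point \<open>v\<close> with
  \<open>norm (x - v)\<close> at most \<open>K * t * norm g\<close>, so replacing \<open>v\<close>
  by \<open>x\<close> in the linear term costs the quadratic error. It is applied with
  \<open>p\<close> in \<open>F\<close>, and with \<open>p = x n\<close> to locate
  \<open>ybar n\<close>.\<close>

lemma lyapunov_projected_step_le:
  fixes C :: "'a set" and g :: "'a \<Rightarrow>\<^sub>L real"
  assumes C: "C \<noteq> {}" "closed C" "convex C" and "p \<in> C" "0 \<le> t"
    and K: "\<And>x y :: 'a. norm (x - y) \<le> K * norm (duality_map x - duality_map y)"
  shows "lyapunov p (generalized_projection C (duality_map_inv (duality_map x - t *\<^sub>R g)))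
      \<le> lyapunov p x - 2 * t * g (x - p) + 2 * K * t\<^sup>2 * (norm g)\<^sup>2"
proof -
  define v where "v = duality_map_inv (duality_map x - t *\<^sub>R g)"
  have Jv: "duality_map v = duality_map x - t *\<^sub>R g" by (simp add: v_def)
  have "lyapunov p (generalized_projection C v) + lyapunov (generalized_projection C v) v \<le> lyapunov p v"
    using generalized_projection_exists[OF C, where x = v] assms(3,4) by (intro minimizer_three_point) auto
  then have "lyapunov p (generalized_projection C v) \<le> lyapunov p v"
    using lyapunov_nonneg[of "generalized_projection C v" v] by linarith
  also have "\<dots> \<le> lyapunov p x - 2 * t * g (x - p) + 2 * t * g (x - v)"
    using lyapunov_three_point[of p x v] lyapunov_nonneg[of v x]
    by (simp add: Jv blinfun.bilinear_simps algebra_simps)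
  finally have 1: "lyapunov p (generalized_projection C v) \<le> lyapunov p x - 2 * t * g (x - p) + 2 * t * g (x - v)" .
  have "g (x - v) \<le> norm g * norm (x - v)" using norm_blinfun[of g "x - v"] by simp
  also have "\<dots> \<le> norm g * (K * (t * norm g))"
    using K[of x v] assms(5) by (intro mult_left_mono) (simp_all add: Jv)
  finally have "2 * t * g (x - v) \<le> 2 * t * (norm g * (K * (t * norm g)))"
    using assms(5) by (intro mult_left_mono) auto
  also have "\<dots> = 2 * K * t\<^sup>2 * (norm g)\<^sup>2" by (simp add: power2_eq_square mult_ac)
  finally show ?thesis using 1 by (simp add: v_def)
qed

text \<open>The convexity defect of the squared dual norm is exactly an average of Lyapunov distances; this
  replaces uniform convexity of the dual on bounded sets.\<close>

lemma lyapunov_barycenter: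
  fixes s :: "'i \<Rightarrow> 'a"
  assumes "(\<Sum>i\<in>I. w i) = 1" "duality_map v = (\<Sum>i\<in>I. w i *\<^sub>R duality_map (s i))"
  shows "lyapunov p v = (\<Sum>i\<in>I. w i * lyapunov p (s i)) - (\<Sum>i\<in>I. w i * lyapunov v (s i))"
proof -
  \<comment> \<open>Only the first two terms depend on \<open>q\<close>; subtracting the case
    \<open>q = v\<close> from \<open>q = p\<close> leaves \<open>lyapunov p v\<close>.\<close>
  have *: "(\<Sum>i\<in>I. w i * lyapunov q (s i)) = (norm q)\<^sup>2 - 2 * duality_map v q + (\<Sum>i\<in>I. w i * (norm (s i))\<^sup>2)" for q
  proof -
    have "(\<Sum>i\<in>I. w i * lyapunov q (s i))
        = (\<Sum>i\<in>I. w i) * (norm q)\<^sup>2 - 2 * (\<Sum>i\<in>I. w i * duality_map (s i) q) + (\<Sum>i\<in>I. w i * (norm (s i))\<^sup>2)"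
      by (simp add: lyapunov_def algebra_simps sum.distrib sum_subtractf sum_distrib_left sum_distrib_right)
    then show ?thesis by (simp add: assms blinfun.sum_left blinfun.scaleR_left)
  qed
  show ?thesis unfolding * by (simp add: lyapunov_def)
qed

lemma closed_lyapunov_halfspace: "closed {v :: 'a. lyapunov v u \<le> lyapunov v x + e}"
  by (intro closed_Collect_le continuous_intros continuous_at_imp_continuous_on)
    (auto simp: isCont_def intro!: tendsto_intros)

text \<open>The terms \<open>(norm v)\<^sup>2\<close> cancel, so the condition is affine in
  \<open>v\<close>.\<close>

lemma convex_lyapunov_halfspace: "convex {v :: 'a. lyapunov v u \<le> lyapunov v x + e}"
proof -
  have "{v :: 'a. lyapunov v u \<le> lyapunov v x + e}
      = {v. 2 * (duality_map x - duality_map u) v \<le> (norm x)\<^sup>2 - (norm u)\<^sup>2 + e}"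
    by (auto simp: lyapunov_def blinfun.bilinear_simps)
  also have "convex \<dots>"
    unfolding convex_def
  proof (intro ballI allI impI CollectI)
    fix v w and s t m :: real
    define q where "q = (\<lambda>v. 2 * (duality_map x - duality_map u) v)"
    define m where "m = (norm x)\<^sup>2 - (norm u)\<^sup>2 + e"
    assume "v \<in> {v. 2 * (duality_map x - duality_map u) v \<le> (norm x)\<^sup>2 - (norm u)\<^sup>2 + e}"
      "w \<in> {v. 2 * (duality_map x - duality_map u) v \<le> (norm x)\<^sup>2 - (norm u)\<^sup>2 + e}"
      and st: "0 \<le> s" "0 \<le> t" "s + t = 1"
    then have "q v \<le> m" "q w \<le> m" by (auto simp: q_def m_def)
    then have "s * q v + t * q w \<le> s * m + t * m" using st by (intro add_mono mult_left_mono) auto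
    also have "\<dots> = m" using st by (simp flip: distrib_right)
    finally show "2 * (duality_map x - duality_map u) (s *\<^sub>R v + t *\<^sub>R w) \<le> (norm x)\<^sup>2 - (norm u)\<^sup>2 + e"
      by (simp add: q_def m_def blinfun.bilinear_simps algebra_simps)
  qed
  finally show ?thesis .
qed

end

lemma equilibrium_bifunctionI:
  fixes C :: "'a::real_normed_vector set" and f :: "'a \<Rightarrow> 'a \<Rightarrow> real"
  assumes "\<And>v. v \<in> C \<Longrightarrow> f v v = 0"
    and "\<And>v w. v \<in> C \<Longrightarrow> w \<in> C \<Longrightarrow> f v w + f w v \<le> 0"
    and A3: "\<And>v w q. v \<in> C \<Longrightarrow> w \<in> C \<Longrightarrow> q \<in> C \<Longrightarrow>
      Limsup (at_right 0) (\<lambda>t. ereal (f (t *\<^sub>R q + (1 - t) *\<^sub>R v) w)) \<le> ereal (f v w)"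
    and A4: "\<And>v. v \<in> C \<Longrightarrow> convex_on C (f v) \<and> lower_semicontinuous_on C (f v)"
  shows "equilibrium_bifunction C f"
proof
  fix v w q and e :: real assume vw: "v \<in> C" "w \<in> C" and e: "0 < e"
  show "\<exists>\<delta>>0. \<forall>t. 0 < t \<and> t < \<delta> \<longrightarrow> f (t *\<^sub>R q + (1 - t) *\<^sub>R v) w < f v w + e" if "q \<in> C"
  proof -
    have "Limsup (at_right 0) (\<lambda>t. ereal (f (t *\<^sub>R q + (1 - t) *\<^sub>R v) w)) < ereal (f v w + e)"
      by (rule le_less_trans[OF A3[OF vw that]]) (use e in simp)
    then have "\<forall>\<^sub>F t in at_right 0. ereal (f (t *\<^sub>R q + (1 - t) *\<^sub>R v) w) < ereal (f v w + e)"
      by (rule Limsup_lessD)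
    then show ?thesis by (auto simp: eventually_at_right_field)
  qed
  show "\<exists>\<delta>>0. \<forall>q\<in>C. dist q w < \<delta> \<longrightarrow> f v w - e < f v q"
  proof -
    have "ereal (f v w - e) < ereal (f v w)" using e by simp
    also have "\<dots> \<le> Liminf (at w within C) (\<lambda>y. ereal (f v y))"
      using A4[OF vw(1)] vw(2) by (simp add: lower_semicontinuous_on_def)
    finally have "\<forall>\<^sub>F y in at w within C. ereal (f v w - e) < ereal (f v y)" by (rule less_LiminfD)
    then obtain d where "d > 0" "\<And>q. q \<in> C \<Longrightarrow> q \<noteq> w \<Longrightarrow> dist q w < d \<Longrightarrow> f v w - e < f v q"
      by (auto simp: eventually_at)
    \<comment> \<open>The filter \<open>at w within C\<close> leaves out \<open>w\<close>
      itself.\<close>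
    moreover have "f v w - e < f v w" using e by simp
    ultimately show ?thesis by metis
  qed
qed (use assms in auto)

lemma inverse_strongly_monotone_on_lipschitz:
  assumes "inverse_strongly_monotone_on \<alpha> C A" "0 < \<alpha>" "v \<in> C" "w \<in> C"
  shows "norm (A v - A w) \<le> norm (v - w) / \<alpha>"
proof (cases "A v = A w")
  case False
  have "\<alpha> * (norm (A v - A w))\<^sup>2 \<le> (A v - A w) (v - w)"
    using assms by (auto simp: inverse_strongly_monotone_on_def)
  also have "\<dots> \<le> norm (A v - A w) * norm (v - w)" using norm_blinfun[of "A v - A w" "v - w"] by simp
  finally have "norm (A v - A w) * (\<alpha> * norm (A v - A w)) \<le> norm (A v - A w) * norm (v - w)"
    by (simp add: power2_eq_square mult_ac)
  then have "\<alpha> * norm (A v - A w) \<le> norm (v - w)" using False by (subst (asm) mult_le_cancel_left_pos) auto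
  then show ?thesis using assms(2) by (simp add: field_simps)
qed (use assms in simp)

theorem theorem3p2:
  fixes C F :: "'a::banach set"
    and A :: "nat \<Rightarrow> 'a \<Rightarrow> ('a \<Rightarrow>\<^sub>L real)"
    and f :: "nat \<Rightarrow> 'a \<Rightarrow> 'a \<Rightarrow> real"
    and S :: "nat \<Rightarrow> 'a \<Rightarrow> 'a"
    and M N K :: nat
    and \<alpha> L \<omega> a b c d :: real
    and k lam r \<epsilon> :: "nat \<Rightarrow> real"
    and al :: "nat \<Rightarrow> nat \<Rightarrow> real"
    and x0 :: 'a
    and x ybar z ubar :: "nat \<Rightarrow> 'a"
    and y u :: "nat \<Rightarrow> nat \<Rightarrow> 'a"
    and im lm :: "nat \<Rightarrow> nat"
    and Cs :: "nat \<Rightarrow> 'a set"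
  assumes E: "uniformly_smooth TYPE('a)" "two_uniformly_convex TYPE('a)"
    and C: "C \<noteq> {}" "closed C" "convex C"
    and MNK: "1 \<le> M" "1 \<le> N" "1 \<le> K"
    and alpha: "0 < \<alpha>"
    and V1: "\<And>i. i \<in> {1..M} \<Longrightarrow> inverse_strongly_monotone_on \<alpha> C (A i)"
    and V2: "\<And>i. i \<in> {1..M} \<Longrightarrow> VI (A i) C \<noteq> {}"
    and V3: "\<And>i v w. \<lbrakk>i \<in> {1..M}; v \<in> C; w \<in> VI (A i) C\<rbrakk> \<Longrightarrow> norm (A i v) \<le> norm (A i v - A i w)"
    and A1: "\<And>j v. \<lbrakk>j \<in> {1..K}; v \<in> C\<rbrakk> \<Longrightarrow> f j v v = 0"
    and A2: "\<And>j v w. \<lbrakk>j \<in> {1..K}; v \<in> C; w \<in> C\<rbrakk> \<Longrightarrow> f j v w + f j w v \<le> 0"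
    and A3: "\<And>j v w q. \<lbrakk>j \<in> {1..K}; v \<in> C; w \<in> C; q \<in> C\<rbrakk> \<Longrightarrow>
               Limsup (at_right 0) (\<lambda>t. ereal (f j (t *\<^sub>R q + (1 - t) *\<^sub>R v) w)) \<le> ereal (f j v w)"
    and A4: "\<And>j v. \<lbrakk>j \<in> {1..K}; v \<in> C\<rbrakk> \<Longrightarrow> convex_on C (f j v) \<and> lower_semicontinuous_on C (f j v)"
    and S_maps: "\<And>j. j \<in> {1..N} \<Longrightarrow> S j \<in> C \<rightarrow> C"
    and L: "0 < L" "\<And>j. j \<in> {1..N} \<Longrightarrow> uniformly_lipschitz_on L C (S j)"
    and S_quasi: "\<And>j. j \<in> {1..N} \<Longrightarrow> quasi_phi_asymptotically_nonexpansive_on k C (S j)"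
    and F: "F = (\<Inter>i\<in>{1..M}. VI (A i) C) \<inter> (\<Inter>j\<in>{1..N}. fixed_points (S j) C)
                \<inter> (\<Inter>j\<in>{1..K}. EP (f j) C)"
    and F_nonempty: "F \<noteq> {}"
    and F_bounded: "0 < \<omega>" "F \<subseteq> {v \<in> C. norm v \<le> \<omega>}"
    and al_range: "\<And>n j. j \<le> N \<Longrightarrow> 0 \<le> al n j \<and> al n j \<le> 1"
    and al_sum: "\<And>n. (\<Sum>j=0..N. al n j) = 1"
    and al_liminf: "\<And>j. j \<in> {1..N} \<Longrightarrow> 0 < liminf (\<lambda>n. ereal (al n 0 * al n j))"
    and c: "c = uniform_convexity_c TYPE('a)"
    and ab: "a \<in> {0<..<\<alpha> * c\<^sup>2 / 2}" "b \<in> {0<..<\<alpha> * c\<^sup>2 / 2}"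
    and lam: "\<And>n. lam n \<in> {a..b}"
    and r: "0 < d" "\<And>n. d \<le> r n"
    and x0: "x0 \<in> C" "x 0 = x0"
    and Cs0: "Cs 0 = C"
    and y: "\<And>n i. i \<in> {1..M} \<Longrightarrow>
              y n i = generalized_projection C
                        (duality_map_inv (duality_map (x n) - lam n *\<^sub>R A i (x n)))"
    and im: "\<And>n. is_arg_max (\<lambda>i. norm (y n i - x n)) (\<lambda>i. i \<in> {1..M}) (im n)"
    and ybar: "\<And>n. ybar n = y n (im n)"
    and z: "\<And>n. z n = duality_map_inv (al n 0 *\<^sub>R duality_map (x n)
                        + (\<Sum>j=1..N. al n j *\<^sub>R duality_map ((S j ^^ n) (ybar n))))"
    and u: "\<And>n j. j \<in> {1..K} \<Longrightarrow> u n j = resolvent (f j) C (r n) (z n)"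
    and lm: "\<And>n. is_arg_max (\<lambda>j. norm (u n j - x n)) (\<lambda>j. j \<in> {1..K}) (lm n)"
    and ubar: "\<And>n. ubar n = u n (lm n)"
    and eps: "\<And>n. \<epsilon> n = (k n - 1) * (\<omega> + norm (x n))\<^sup>2"
    and Cs_Suc: "\<And>n. Cs (Suc n) = {v \<in> Cs n. lyapunov v (ubar n) \<le> lyapunov v (x n) + \<epsilon> n}"
    and x_Suc: "\<And>n. x (Suc n) = generalized_projection (Cs (Suc n)) x0"
  shows "x \<longlonglongrightarrow> generalized_projection F x0"
proof -

  \<comment> \<open>Constants, index ranges and membership in \<open>C\<close>\<close>
  interpret smooth_two_convex_space "TYPE('a)" by unfold_locales (rule E)+
  note cpos = uniform_convexity_c(1)[folded c] and c_le = uniform_convexity_c(2)[folded c]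
  define \<kappa> where "\<kappa> = 2 / c\<^sup>2"
  have \<kappa>: "0 < \<kappa>" using cpos by (simp add: \<kappa>_def)
  have \<kappa>_le: "norm (v - w) \<le> \<kappa> * norm (duality_map v - duality_map w)" for v w :: 'a
    unfolding \<kappa>_def by (rule c_le)
  \<comment> \<open>The upper bound on the step sizes, in the form that makes \<gamma> below
    positive.\<close>
  have b\<kappa>: "b * \<kappa> < \<alpha>" using ab(2) cpos by (simp add: \<kappa>_def field_simps)
  have a0: "0 < a" and lam_pos: "\<And>n. 0 < lam n" "\<And>n. a \<le> lam n" "\<And>n. lam n \<le> b"
    using ab(1) lam by (auto intro: less_le_trans)
  have rpos: "0 < r n" for n using r(1) r(2)[of n] by linarith
  have one: "1 \<in> {1..M}" "1 \<in> {1..N}" "1 \<in> {1..K}" using MNK by auto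
  have im_in: "im n \<in> {1..M}"
    and im_max: "\<And>i. i \<in> {1..M} \<Longrightarrow> norm (y n i - x n) \<le> norm (ybar n - x n)" for n
    using im[of n] by (auto simp: is_arg_max_linorder ybar)
  have lm_in: "lm n \<in> {1..K}" and lm_max: "\<And>j. j \<in> {1..K} \<Longrightarrow> norm (u n j - x n) \<le> norm (ubar n - x n)" for n
    using lm[of n] by (auto simp: is_arg_max_linorder ubar)
  have eb: "equilibrium_bifunction C (f j)" if "j \<in> {1..K}" for j
    by (rule equilibrium_bifunctionI) (use A1 A2 A3 A4 that in auto)
  have k1: "\<And>n. 1 \<le> k n" and k_lim: "k \<longlonglongrightarrow> 1"
    using S_quasi[OF one(2)] by (auto simp: quasi_phi_asymptotically_nonexpansive_on_def)
  have FC: "p \<in> C" "norm p \<le> \<omega>" if "p \<in> F" for p using that F_bounded by auto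

  have y_in: "y n i \<in> C" if "i \<in> {1..M}" for n i
    unfolding y[OF that] by (rule generalized_projection_exists(1)[OF C])
  have ybar_in: "ybar n \<in> C" for n unfolding ybar by (rule y_in[OF im_in])
  have S_pow_in: "(S j ^^ n) v \<in> C" if "j \<in> {1..N}" "v \<in> C" for j n v
    using that(2) S_maps[OF that(1)] by (induction n) auto
  have u_in: "u n j \<in> C" if "j \<in> {1..K}" for n j
    unfolding u[OF that] by (rule resolvent_solution(1)[OF eb[OF that] rpos C])

  \<comment> \<open>One step of the iteration, measured from a point of \<open>F\<close>\<close>
  define s where "s = (\<lambda>n j. if j = 0 then x n else (S j ^^ n) (ybar n))"
  \<comment> \<open>The averaging defect from \<open>lyapunov_barycenter\<close>; index 0 of
    \<open>s n\<close> stands for \<open>x n\<close>, so that \<open>z n\<close> is one barycenter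
    over \<open>0..N\<close>.\<close>
  define D where "D = (\<lambda>n. \<Sum>j=0..N. al n j * lyapunov (z n) (s n j))"
  define Ax where "Ax = (\<lambda>n. A (im n) (x n))"
  define \<beta> where "\<beta> = (\<lambda>n. \<Sum>j=1..N. al n j)"
  \<comment> \<open>A lower bound, uniform in \<open>n\<close>, for
    \<open>2 * lam n * (\<alpha> - lam n * \<kappa>)\<close>.\<close>
  define \<gamma> where "\<gamma> = 2 * a * (\<alpha> - b * \<kappa>)"
  have \<gamma>: "0 < \<gamma>" using a0 b\<kappa> by (simp add: \<gamma>_def)
  have al0: "0 \<le> al n j" "al n j \<le> 1" if "j \<le> N" for n j using al_range[OF that] by auto
  have D_nonneg: "0 \<le> D n" for n
    unfolding D_def by (intro sum_nonneg mult_nonneg_nonneg al0 lyapunov_nonneg) auto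
  have \<beta>_nonneg: "0 \<le> \<beta> n" for n unfolding \<beta>_def by (intro sum_nonneg al0) auto
  have gain_nonneg: "0 \<le> \<beta> n * \<gamma> * (norm (Ax n))\<^sup>2" for n
    using \<beta>_nonneg \<gamma> by (intro mult_nonneg_nonneg) auto
  have Jz: "duality_map (z n) = (\<Sum>j=0..N. al n j *\<^sub>R duality_map (s n j))" for n
    by (simp add: z s_def sum.atLeast_Suc_atMost)

  have step: "lyapunov p (ubar n) + (\<beta> n * \<gamma> * (norm (Ax n))\<^sup>2 + D n) \<le> lyapunov p (x n) + \<epsilon> n"
    if p: "p \<in> F" and xC: "x n \<in> C" for p n
  proof -
    have pVI: "p \<in> VI (A (im n)) C" using p im_in[of n] by (auto simp: F)
    \<comment> \<open>(V3) at the solution \<open>p\<close> itself forces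
      \<open>A (im n) p = 0\<close>; inverse strong monotonicity then controls \<open>Ax n\<close>
      rather than a difference.\<close>
    have "norm (A (im n) p) \<le> norm (A (im n) p - A (im n) p)"
      by (rule V3[OF im_in FC(1)[OF p] pVI])
    then have Ap: "A (im n) p = 0" by simp
    have "\<alpha> * (norm (A (im n) (x n) - A (im n) p))\<^sup>2 \<le> (A (im n) (x n) - A (im n) p) (x n - p)"
      using V1[OF im_in] xC FC(1)[OF p] by (auto simp: inverse_strongly_monotone_on_def)
    then have mono: "\<alpha> * (norm (Ax n))\<^sup>2 \<le> Ax n (x n - p)" by (simp add: Ap Ax_def)
    have "lyapunov p (ybar n) \<le> lyapunov p (x n) - 2 * lam n * Ax n (x n - p) + 2 * \<kappa> * (lam n)\<^sup>2 * (norm (Ax n))\<^sup>2"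
      unfolding ybar y[OF im_in] Ax_def
      by (rule lyapunov_projected_step_le[OF C FC(1)[OF p] less_imp_le[OF lam_pos(1)] \<kappa>_le])
    also have "\<dots> \<le> lyapunov p (x n) - \<gamma> * (norm (Ax n))\<^sup>2"
    proof -
      have "lam n * (\<alpha> * (norm (Ax n))\<^sup>2) \<le> lam n * Ax n (x n - p)"
        using mono lam_pos(1)[of n] by (intro mult_left_mono) auto
      moreover have "a * (\<alpha> - b * \<kappa>) \<le> lam n * (\<alpha> - lam n * \<kappa>)"
        using lam_pos[of n] a0 b\<kappa> \<kappa> by (intro mult_mono) (auto simp: mult_right_mono)
      then have "a * (\<alpha> - b * \<kappa>) * (norm (Ax n))\<^sup>2 \<le> lam n * (\<alpha> - lam n * \<kappa>) * (norm (Ax n))\<^sup>2"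
        by (rule mult_right_mono) simp
      ultimately show ?thesis by (simp add: \<gamma>_def power2_eq_square algebra_simps)
    qed
    finally have py: "lyapunov p (ybar n) \<le> lyapunov p (x n) - \<gamma> * (norm (Ax n))\<^sup>2" .
    define G where "G = \<gamma> * (norm (Ax n))\<^sup>2"
    have G: "0 \<le> G" using \<gamma> by (simp add: G_def)
    have kmul: "w \<le> k n * w" if "0 \<le> w" for w
      using mult_right_mono[OF k1[of n] that] by simp
    have s0: "lyapunov p (s n 0) \<le> k n * lyapunov p (x n)"
      by (simp add: s_def kmul lyapunov_nonneg)
    have sj: "lyapunov p (s n j) \<le> k n * lyapunov p (x n) - G" if j: "j \<in> {1..N}" for j
    proof -
      have pj: "p \<in> fixed_points (S j) C" using p j by (auto simp: F)
      have "lyapunov p (s n j) \<le> k n * lyapunov p (ybar n)"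
      \<comment> \<open>The quasi-nonexpansive estimate starts at \<open>n = 1\<close>. At 0 the
        power is the identity, and \<open>1 \<le> k 0\<close> suffices.\<close>
      proof (cases "n = 0")
        case True
        then show ?thesis using kmul[OF lyapunov_nonneg[of p "ybar n"]] j by (simp add: s_def)
      next
        case False
        then show ?thesis
          using S_quasi[OF j] pj ybar_in[of n] j
          by (auto simp: s_def quasi_phi_asymptotically_nonexpansive_on_def)
      qed
      also have "\<dots> \<le> k n * (lyapunov p (x n) - G)"
        using py k1[of n] by (intro mult_left_mono) (auto simp: G_def)
      also have "\<dots> \<le> k n * lyapunov p (x n) - G" using kmul[OF G] by (simp add: right_diff_distrib)
      finally show ?thesis .
    qed
    have "lyapunov p (ubar n) \<le> lyapunov p (z n)"
      unfolding ubar u[OF lm_in]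
      by (rule lyapunov_resolvent_le[OF eb[OF lm_in] rpos C]) (use p lm_in[of n] in \<open>auto simp: F\<close>)
    also have "\<dots> = (\<Sum>j=0..N. al n j * lyapunov p (s n j)) - D n"
      unfolding D_def by (rule lyapunov_barycenter[OF al_sum Jz])
    also have "(\<Sum>j=0..N. al n j * lyapunov p (s n j))
        = al n 0 * lyapunov p (s n 0) + (\<Sum>j=1..N. al n j * lyapunov p (s n j))"
      by (simp add: sum.atLeast_Suc_atMost)
    also have "\<dots> \<le> al n 0 * (k n * lyapunov p (x n)) + (\<Sum>j=1..N. al n j * (k n * lyapunov p (x n) - G))"
      using s0 sj al0 by (intro add_mono mult_left_mono sum_mono) auto
    also have "\<dots> = (al n 0 + \<beta> n) * (k n * lyapunov p (x n)) - \<beta> n * G"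
      by (simp add: \<beta>_def distrib_right right_diff_distrib sum_subtractf sum_distrib_right)
    also have "al n 0 + \<beta> n = 1" using al_sum[of n] by (simp add: \<beta>_def sum.atLeast_Suc_atMost)
    finally have "lyapunov p (ubar n) + (\<beta> n * G + D n) \<le> k n * lyapunov p (x n)" by simp
    also have "\<dots> = lyapunov p (x n) + (k n - 1) * lyapunov p (x n)" by (simp add: algebra_simps)
    \<comment> \<open>The origin of \<epsilon> n: \<open>lyapunov p (x n)\<close> is at most the
      squared sum of the norms, and \<omega> bounds \<open>norm p\<close> for all \<open>p\<close>
      in \<open>F\<close> at once.\<close>
    also have "(k n - 1) * lyapunov p (x n) \<le> \<epsilon> n"
    proof -
      have "lyapunov p (x n) \<le> (norm p + norm (x n))\<^sup>2" by (rule lyapunov_le)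
      also have "\<dots> \<le> (\<omega> + norm (x n))\<^sup>2" using FC(2)[OF p] by (intro power_mono) auto
      finally show ?thesis unfolding eps using k1[of n] by (intro mult_left_mono) auto
    qed
    finally show ?thesis by (simp add: G_def mult.assoc)
  qed

  \<comment> \<open>The nested sets and minimality of the iterates\<close>
  have Cs: "closed (Cs n) \<and> convex (Cs n) \<and> Cs n \<subseteq> C \<and> F \<subseteq> Cs n \<and> x n \<in> Cs n
      \<and> (\<forall>v\<in>Cs n. lyapunov (x n) x0 \<le> lyapunov v x0)" for n
  \<comment> \<open>The claims support each other: \<open>step\<close> needs \<open>x n\<close> in
    \<open>C\<close>, it puts \<open>F\<close> into the next set, and this makes the next projection
    exist.\<close>
  proof (induction n)
    case 0
    show ?case using C x0 FC by (auto simp: Cs0 lyapunov_nonneg)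
  next
    case (Suc n)
    define H where "H = {v. lyapunov v (ubar n) \<le> lyapunov v (x n) + \<epsilon> n}"
    have eq: "Cs (Suc n) = Cs n \<inter> H" by (auto simp: Cs_Suc H_def)
    have H: "closed H" "convex H" unfolding H_def
      by (rule closed_lyapunov_halfspace, rule convex_lyapunov_halfspace)
    have xC: "x n \<in> C" using Suc by blast
    have "F \<subseteq> H"
    proof
      fix p assume "p \<in> F"
      from step[OF this xC] show "p \<in> H"
        using gain_nonneg[of n] D_nonneg[of n] by (simp add: H_def)
    qed
    then have *: "closed (Cs (Suc n))" "convex (Cs (Suc n))" "Cs (Suc n) \<subseteq> C" "F \<subseteq> Cs (Suc n)"
      using Suc H unfolding eq by (auto intro: closed_Int convex_Int)
    then have ne: "Cs (Suc n) \<noteq> {}" using F_nonempty by blast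
    show ?case
      using * generalized_projection_exists[OF ne *(1,2), where x = x0] unfolding x_Suc by blast
  qed
  have xC: "x n \<in> C" for n using Cs[of n] by blast
  have Cs_mono: "Cs m \<subseteq> Cs n" if "n \<le> m" for m n
    using that by (induction rule: dec_induct) (auto simp: Cs_Suc)
  have x_in: "x m \<in> Cs n" if "n \<le> m" for m n using Cs_mono[OF that] Cs[of m] by blast

  \<comment> \<open>Strong convergence of the iterates\<close>
  define d0 where "d0 = (\<lambda>n. lyapunov (x n) x0)"
  \<comment> \<open>Later iterates \<open>x m\<close> lie in \<open>Cs n\<close>, over which
    \<open>x n\<close> is the minimizer.\<close>
  have three: "lyapunov (x m) (x n) \<le> d0 m - d0 n" if "n \<le> m" for m n
    using minimizer_three_point[of "Cs n" "x n" "x m" x0] Cs[of n] x_in[OF that] by (simp add: d0_def)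
  obtain p where p: "p \<in> F" using F_nonempty by blast
  have "convergent d0"
  proof (rule Bseq_monoseq_convergent)
    have "0 \<le> d0 n \<and> d0 n \<le> lyapunov p x0" for n
      using Cs[of n] p by (auto simp: d0_def lyapunov_nonneg)
    then show "Bseq d0" by (intro BseqI'[of _ "lyapunov p x0"]) auto
    have "incseq d0"
    unfolding incseq_def
    proof (intro allI impI)
      fix n m :: nat assume "n \<le> m"
      then show "d0 n \<le> d0 m" using three[of n m] lyapunov_nonneg[of "x m" "x n"] by linarith
    qed
    then show "monoseq d0" by (rule incseq_imp_monoseq)
  qed
  then have d0: "Cauchy d0" by (simp add: Cauchy_convergent_iff)
  have "Cauchy x"
    unfolding Cauchy_altdef2
  proof (intro allI impI)
    fix e :: real assume "e > 0"
    then have "2 * convexity_constant * e\<^sup>2 > 0" using convexity_constant_pos by simp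
    then obtain n0 where n0: "\<And>n. n \<ge> n0 \<Longrightarrow> dist (d0 n) (d0 n0) < 2 * convexity_constant * e\<^sup>2"
      using d0 unfolding Cauchy_altdef2 by blast
    have "dist (x n) (x n0) < e" if "n \<ge> n0" for n
    proof -
      have "2 * convexity_constant * (norm (x n - x n0))\<^sup>2 \<le> d0 n - d0 n0"
        using lyapunov_ge[of "x n" "x n0"] three[OF that] by linarith
      also have "\<dots> < 2 * convexity_constant * e\<^sup>2" using n0[OF that] unfolding dist_real_def by linarith
      finally have "(norm (x n - x n0))\<^sup>2 < e\<^sup>2" using convexity_constant_pos by simp
      then show ?thesis using \<open>e > 0\<close> by (simp add: dist_norm power2_less_imp_less)
    qed
    then show "\<exists>N. \<forall>n\<ge>N. dist (x n) (x N) < e" by blast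
  qed
  then obtain xs where xs: "x \<longlonglongrightarrow> xs" using Cauchy_convergent_iff convergent_def by blast
  have xs_Cs: "xs \<in> Cs n" for n
    using closed_sequentially[of "Cs n" "\<lambda>m. x (m + n)" xs] Cs[of n] x_in[of n] LIMSEQ_ignore_initial_segment[OF xs]
    by simp
  then have xsC: "xs \<in> C" using Cs0 by metis
  have xs_min: "lyapunov xs x0 \<le> lyapunov v x0" if v: "v \<in> (\<Inter>n. Cs n)" for v
  proof (rule LIMSEQ_le_const2)
    show "(\<lambda>n. lyapunov (x n) x0) \<longlonglongrightarrow> lyapunov xs x0" by (intro tendsto_intros xs)
    show "\<exists>N. \<forall>n\<ge>N. lyapunov (x n) x0 \<le> lyapunov v x0" using Cs v by blast
  qed

  \<comment> \<open>Limits of the resolvents\<close>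
  have eps_lim: "\<epsilon> \<longlonglongrightarrow> 0"
  proof -
    have "(\<lambda>n. (k n - 1) * (\<omega> + norm (x n))\<^sup>2) \<longlonglongrightarrow> (1 - 1) * (\<omega> + norm xs)\<^sup>2"
      by (intro tendsto_intros xs k_lim)
    then show ?thesis by (simp flip: eps)
  qed
  have xSuc: "(\<lambda>n. x (Suc n)) \<longlonglongrightarrow> xs" by (rule LIMSEQ_Suc[OF xs])
  have toxs: "g \<longlonglongrightarrow> xs" if "(\<lambda>n. x n - g n) \<longlonglongrightarrow> 0" for g
    using tendsto_diff[OF xs that] by simp
  have ubar_lim: "ubar \<longlonglongrightarrow> xs"
  proof -
    have "(\<lambda>n. lyapunov (x (Suc n)) (ubar n)) \<longlonglongrightarrow> 0"
    proof (rule tendsto_sandwich[OF _ _ tendsto_const])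
      have "(\<lambda>n. lyapunov (x (Suc n)) (x n) + \<epsilon> n) \<longlonglongrightarrow> lyapunov xs xs + 0"
        by (intro tendsto_intros xs xSuc eps_lim)
      then show "(\<lambda>n. lyapunov (x (Suc n)) (x n) + \<epsilon> n) \<longlonglongrightarrow> 0" by simp
      \<comment> \<open>Membership of the next iterate in the set just cut out is the comparison of
        its distances to \<open>ubar n\<close> and \<open>x n\<close>.\<close>
      have "x (Suc n) \<in> Cs (Suc n)" for n using Cs by blast
      then show "\<forall>\<^sub>F n in sequentially. lyapunov (x (Suc n)) (ubar n) \<le> lyapunov (x (Suc n)) (x n) + \<epsilon> n"
        by (simp add: Cs_Suc)
    qed (simp add: lyapunov_nonneg)
    from tendsto_diff[OF xSuc lyapunov_tendsto_zeroD[OF this]] show ?thesis by simp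
  qed
  \<comment> \<open>Only the farthest resolvent drives the iteration; maximality passes its limit on
    to every index.\<close>
  have u_lim: "(\<lambda>n. u n j) \<longlonglongrightarrow> xs" if j: "j \<in> {1..K}" for j
  proof -
    have "(\<lambda>n. norm (ubar n - x n)) \<longlonglongrightarrow> norm (xs - xs)" by (intro tendsto_intros ubar_lim xs)
    then have null: "(\<lambda>n. norm (ubar n - x n)) \<longlonglongrightarrow> 0" by simp
    have "(\<lambda>n. u n j - x n) \<longlonglongrightarrow> 0"
      by (rule Lim_null_comparison[OF _ null]) (use lm_max[OF j] in simp)
    from tendsto_add[OF this xs] show ?thesis by simp
  qed

  \<comment> \<open>The vanishing slack \<open>Q\<close> and what it forces\<close>
  define Q where "Q = (\<lambda>n. lyapunov p (x n) + \<epsilon> n - lyapunov p (ubar n))"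
  have Q_lim: "Q \<longlonglongrightarrow> 0"
  proof -
    have "Q \<longlonglongrightarrow> lyapunov p xs + 0 - lyapunov p xs"
      unfolding Q_def by (intro tendsto_intros xs eps_lim ubar_lim)
    then show ?thesis by simp
  qed
  have Q_ge: "D n \<le> Q n" "\<beta> n * \<gamma> * (norm (Ax n))\<^sup>2 \<le> Q n" for n
    using step[OF p xC, of n] D_nonneg[of n] gain_nonneg[of n] unfolding Q_def by linarith+
  have Q_null: "g \<longlonglongrightarrow> 0"
    if "0 < \<eta>" "\<And>n. 0 \<le> g n" "\<forall>\<^sub>F n in sequentially. \<eta> * g n \<le> Q n" for g and \<eta> :: real
  proof (rule tendsto_sandwich[OF _ _ tendsto_const])
    show "\<forall>\<^sub>F n in sequentially. g n \<le> Q n / \<eta>"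
      using that(3) by eventually_elim (use that(1) in \<open>simp add: field_simps\<close>)
    show "(\<lambda>n. Q n / \<eta>) \<longlonglongrightarrow> 0" by (rule tendsto_divide_zero[OF Q_lim])
  qed (use that in simp)
  \<comment> \<open>Both weights are at most 1, so a lower bound for their product is one for each
    factor.\<close>
  have al_ev: "\<exists>\<eta>>0. \<forall>\<^sub>F n in sequentially. \<eta> \<le> al n 0 \<and> \<eta> \<le> al n j" if j: "j \<in> {1..N}" for j
  proof -
    obtain \<eta> where \<eta>: "0 < ereal \<eta>" "ereal \<eta> < liminf (\<lambda>n. ereal (al n 0 * al n j))"
      using ereal_dense2[OF al_liminf[OF j]] by auto
    have "\<forall>\<^sub>F n in sequentially. ereal \<eta> < ereal (al n 0 * al n j)" by (rule less_LiminfD[OF \<eta>(2)])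
    then have "\<forall>\<^sub>F n in sequentially. \<eta> \<le> al n 0 \<and> \<eta> \<le> al n j"
    proof eventually_elim
      case (elim n)
      have "al n 0 * al n j \<le> al n 0" "al n 0 * al n j \<le> al n j"
        using al0[of 0 n] al0[of j n] j by (auto simp: mult_left_le mult_left_le_one_le)
      then show ?case using elim by simp
    qed
    then show ?thesis using \<eta>(1) by auto
  qed
  have zs_lim: "(\<lambda>n. z n - s n j) \<longlonglongrightarrow> 0" if j: "j \<le> N" for j
  proof (rule lyapunov_tendsto_zeroD)
    have "\<exists>\<eta>>0. \<forall>\<^sub>F n in sequentially. \<eta> \<le> al n j"
    proof (cases "j = 0")
      case True
      then show ?thesis using al_ev[OF one(2)] by (auto elim: eventually_mono)
    next
      case False
      then show ?thesis using al_ev[of j] j by (auto elim: eventually_mono)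
    qed
    then obtain \<eta> where \<eta>: "0 < \<eta>" "\<forall>\<^sub>F n in sequentially. \<eta> \<le> al n j" by blast
    have "al n j * lyapunov (z n) (s n j) \<le> D n" for n
      unfolding D_def using j al0 by (intro member_le_sum) (auto intro: mult_nonneg_nonneg lyapunov_nonneg)
    then have DQ: "al n j * lyapunov (z n) (s n j) \<le> Q n" for n using Q_ge(1) order_trans by blast
    show "(\<lambda>n. lyapunov (z n) (s n j)) \<longlonglongrightarrow> 0"
    proof (rule Q_null[OF \<eta>(1)])
      show "\<forall>\<^sub>F n in sequentially. \<eta> * lyapunov (z n) (s n j) \<le> Q n"
        using \<eta>(2) by eventually_elim (meson DQ lyapunov_nonneg mult_right_mono order_trans)
    qed (rule lyapunov_nonneg)
  qed
  have z_lim: "z \<longlonglongrightarrow> xs" using tendsto_add[OF zs_lim[of 0] xs] by (simp add: s_def)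
  have Sy_lim: "(\<lambda>n. (S j ^^ n) (ybar n)) \<longlonglongrightarrow> xs" if j: "j \<in> {1..N}" for j
  proof -
    have "(\<lambda>n. z n - (S j ^^ n) (ybar n)) \<longlonglongrightarrow> 0" using zs_lim[of j] j by (simp add: s_def)
    from tendsto_diff[OF z_lim this] show ?thesis by simp
  qed

  have Ax_lim: "(\<lambda>n. (norm (Ax n))\<^sup>2) \<longlonglongrightarrow> 0"
  proof -
    obtain \<eta> where \<eta>: "0 < \<eta>" "\<forall>\<^sub>F n in sequentially. \<eta> \<le> al n 0 \<and> \<eta> \<le> al n 1"
      using al_ev[OF one(2)] by blast
    have "al n 1 \<le> \<beta> n" for n
      unfolding \<beta>_def using one(2) al0 by (intro member_le_sum) auto
    then have \<eta>\<beta>: "\<forall>\<^sub>F n in sequentially. \<eta> \<le> \<beta> n"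
      using \<eta>(2) by (elim eventually_mono) (meson order_trans)
    show ?thesis
    proof (rule Q_null[of "\<eta> * \<gamma>"])
      show "\<forall>\<^sub>F n in sequentially. \<eta> * \<gamma> * (norm (Ax n))\<^sup>2 \<le> Q n"
        using \<eta>\<beta>
      proof eventually_elim
        case (elim n)
        have "\<eta> * \<gamma> * (norm (Ax n))\<^sup>2 \<le> \<beta> n * \<gamma> * (norm (Ax n))\<^sup>2"
          using elim \<gamma> by (intro mult_right_mono) auto
        then show ?case using Q_ge(2)[of n] by linarith
      qed
    qed (use \<eta> \<gamma> in auto)
  qed
  have ybar_lim: "ybar \<longlonglongrightarrow> xs"
  proof (rule toxs, rule lyapunov_tendsto_zeroD, rule tendsto_sandwich[OF _ _ tendsto_const])
    \<comment> \<open>The step estimate at the base point \<open>x n\<close> itself: the linear term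
      vanishes and only the quadratic error in \<open>norm (Ax n)\<close> remains.\<close>
    have "lyapunov (x n) (ybar n) \<le> 2 * \<kappa> * b\<^sup>2 * (norm (Ax n))\<^sup>2" for n
    proof -
      have "lyapunov (x n) (ybar n) \<le> lyapunov (x n) (x n) - 2 * lam n * Ax n (x n - x n) + 2 * \<kappa> * (lam n)\<^sup>2 * (norm (Ax n))\<^sup>2"
        unfolding ybar y[OF im_in] Ax_def
        by (rule lyapunov_projected_step_le[OF C xC less_imp_le[OF lam_pos(1)] \<kappa>_le])
      also have "\<dots> = 2 * \<kappa> * (lam n)\<^sup>2 * (norm (Ax n))\<^sup>2" by (simp add: blinfun.bilinear_simps)
      also have "\<dots> \<le> 2 * \<kappa> * b\<^sup>2 * (norm (Ax n))\<^sup>2"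
        using lam_pos[of n] \<kappa> by (intro mult_right_mono mult_left_mono power_mono) auto
      finally show ?thesis .
    qed
    then show "\<forall>\<^sub>F n in sequentially. lyapunov (x n) (ybar n) \<le> 2 * \<kappa> * b\<^sup>2 * (norm (Ax n))\<^sup>2" by simp
    show "(\<lambda>n. 2 * \<kappa> * b\<^sup>2 * (norm (Ax n))\<^sup>2) \<longlonglongrightarrow> 0" by (rule tendsto_mult_right_zero[OF Ax_lim])
  qed (simp add: lyapunov_nonneg)
  have y_lim: "(\<lambda>n. y n i) \<longlonglongrightarrow> xs" if i: "i \<in> {1..M}" for i
  proof -
    have "(\<lambda>n. norm (ybar n - x n)) \<longlonglongrightarrow> norm (xs - xs)" by (intro tendsto_intros ybar_lim xs)
    then have null: "(\<lambda>n. norm (ybar n - x n)) \<longlonglongrightarrow> 0" by simp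
    have "(\<lambda>n. y n i - x n) \<longlonglongrightarrow> 0"
      by (rule Lim_null_comparison[OF _ null]) (use im_max[OF i] in simp)
    from tendsto_add[OF this xs] show ?thesis by simp
  qed

  \<comment> \<open>The limit lies in every constraint set\<close>
  have "xs \<in> VI (A i) C" if i: "i \<in> {1..M}" for i
  proof -
    have A_lim: "(\<lambda>n. A i (x n)) \<longlonglongrightarrow> A i xs"
    proof (rule LIM_zero_cancel, rule Lim_null_comparison)
      show "\<forall>\<^sub>F n in sequentially. norm (A i (x n) - A i xs) \<le> norm (x n - xs) / \<alpha>"
        using inverse_strongly_monotone_on_lipschitz[OF V1[OF i] alpha xC xsC] by simp
      have "(\<lambda>n. norm (x n - xs) / \<alpha>) \<longlonglongrightarrow> norm (xs - xs) / \<alpha>"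
        by (intro tendsto_intros xs) (use alpha in simp)
      then show "(\<lambda>n. norm (x n - xs) / \<alpha>) \<longlonglongrightarrow> 0" by simp
    qed
    have "0 \<le> A i xs (q - xs)" if q: "q \<in> C" for q
    proof (rule tendsto_le[OF sequentially_bot])
      define e where "e = (\<lambda>n. (duality_map (x n) - duality_map (y n i)) (q - y n i))"
      show "(\<lambda>n. A i (x n) (q - y n i)) \<longlonglongrightarrow> A i xs (q - xs)"
        by (intro tendsto_intros A_lim y_lim i)
      have "(\<lambda>n. - (\<bar>e n\<bar> / a)) \<longlonglongrightarrow> - (\<bar>(duality_map xs - duality_map xs) (q - xs)\<bar> / a)"
        unfolding e_def by (intro tendsto_intros y_lim i xs) (use a0 in simp)
      then show "(\<lambda>n. - (\<bar>e n\<bar> / a)) \<longlonglongrightarrow> 0" by simp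
      \<comment> \<open>The variational inequality of the projection \<open>y n i\<close>, divided
        by \<open>lam n\<close>, has error \<open>e n / lam n\<close>; the lower bound
        \<open>a\<close> keeps this error null.\<close>
      have "- (\<bar>e n\<bar> / a) \<le> A i (x n) (q - y n i)" for n
      proof -
        define v where "v = duality_map_inv (duality_map (x n) - lam n *\<^sub>R A i (x n))"
        have yv: "y n i = generalized_projection C v" by (simp add: y[OF i] v_def)
        have "(duality_map v - duality_map (y n i)) (q - y n i) \<le> 0"
          unfolding yv using generalized_projection_exists[OF C, where x = v] q
          by (intro minimizer_variational[OF C(3)]) auto
        then have "e n \<le> lam n * A i (x n) (q - y n i)"
          by (simp add: v_def e_def blinfun.bilinear_simps right_diff_distrib)
        then have 1: "e n / lam n \<le> A i (x n) (q - y n i)"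
          using lam_pos(1)[of n] by (simp add: field_simps)
        have "- (\<bar>e n\<bar> / a) \<le> - (\<bar>e n\<bar> / lam n)"
          using lam_pos[of n] a0 by (simp add: frac_le)
        also have "\<dots> \<le> e n / lam n"
          using divide_right_mono[of "- \<bar>e n\<bar>" "e n" "lam n"] lam_pos(1)[of n] by simp
        finally show ?thesis using 1 by linarith
      qed
      then show "\<forall>\<^sub>F n in sequentially. - (\<bar>e n\<bar> / a) \<le> A i (x n) (q - y n i)" by simp
    qed
    then show ?thesis using xsC by (simp add: VI_def)
  qed
  moreover have "xs \<in> fixed_points (S j) C" if j: "j \<in> {1..N}" for j
  proof -
    have lip: "dist ((S j ^^ n) v) ((S j ^^ n) w) \<le> L * dist v w" if "1 \<le> n" "v \<in> C" "w \<in> C" for n v w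
      using L(2)[OF j] that by (auto simp: uniformly_lipschitz_on_def intro: lipschitz_onD)
    \<comment> \<open>The constant \<open>L\<close> is common to all powers, so
      \<open>ybar n\<close> may be replaced by its limit inside the \<open>n\<close>-th power.
      Shifting the index then identifies \<open>S j xs\<close> with \<open>xs\<close>.\<close>
    have Sxs: "(\<lambda>n. (S j ^^ n) xs) \<longlonglongrightarrow> xs"
    proof -
      have "(\<lambda>n. (S j ^^ n) xs - (S j ^^ n) (ybar n)) \<longlonglongrightarrow> 0"
      proof (rule Lim_null_comparison)
        show "\<forall>\<^sub>F n in sequentially. norm ((S j ^^ n) xs - (S j ^^ n) (ybar n)) \<le> L * dist xs (ybar n)"
          using eventually_ge_at_top[of 1]
          by eventually_elim (use lip[OF _ xsC ybar_in] in \<open>simp add: dist_norm\<close>)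
        have "(\<lambda>n. L * dist xs (ybar n)) \<longlonglongrightarrow> L * dist xs xs" by (intro tendsto_intros ybar_lim)
        then show "(\<lambda>n. L * dist xs (ybar n)) \<longlonglongrightarrow> 0" by simp
      qed
      from tendsto_add[OF this Sy_lim[OF j]] show ?thesis by simp
    qed
    have "(\<lambda>n. S j ((S j ^^ n) xs)) \<longlonglongrightarrow> S j xs"
    proof (rule LIM_zero_cancel, rule Lim_null_comparison)
      show "\<forall>\<^sub>F n in sequentially. norm (S j ((S j ^^ n) xs) - S j xs) \<le> L * dist ((S j ^^ n) xs) xs"
        using lip[of 1, OF _ S_pow_in[OF j xsC] xsC] by (simp add: dist_norm)
      have "(\<lambda>n. L * dist ((S j ^^ n) xs) xs) \<longlonglongrightarrow> L * dist xs xs" by (intro tendsto_intros Sxs)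
      then show "(\<lambda>n. L * dist ((S j ^^ n) xs) xs) \<longlonglongrightarrow> 0" by simp
    qed
    moreover have "(\<lambda>n. S j ((S j ^^ n) xs)) \<longlonglongrightarrow> xs" using LIMSEQ_Suc[OF Sxs] by simp
    ultimately have "S j xs = xs" by (rule LIMSEQ_unique)
    then show ?thesis using xsC by (simp add: fixed_points_def)
  qed
  moreover have "xs \<in> EP (f j) C" if j: "j \<in> {1..K}" for j
  proof -
    interpret ebj: equilibrium_bifunction C "f j" by (rule eb[OF j])
    \<comment> \<open>The limit is taken in the Minty form: monotonicity moves \<open>u n j\<close>
      into the second argument, where \<open>f j v\<close> is lower semicontinuous.\<close>
    have "f j v xs \<le> 0" if v: "v \<in> C" for v
    proof (rule ebj.lsc_right_limit[OF v xsC u_in[OF j] u_lim[OF j]])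
      define e where "e = (\<lambda>n. (duality_map (u n j) - duality_map (z n)) (v - u n j))"
      have "(\<lambda>n. \<bar>e n\<bar> / d) \<longlonglongrightarrow> \<bar>(duality_map xs - duality_map xs) (v - xs)\<bar> / d"
        unfolding e_def by (intro tendsto_intros u_lim j z_lim) (use r(1) in simp)
      then show "(\<lambda>n. \<bar>e n\<bar> / d) \<longlonglongrightarrow> 0" by simp
      fix n
      have "0 \<le> f j (u n j) v + 1 / r n * e n"
        unfolding e_def u[OF j] by (rule resolvent_solution(2)[OF eb[OF j] rpos C v])
      then have "f j v (u n j) \<le> e n / r n" using ebj.monotone[OF v u_in[OF j, of n]] by simp
      also have "\<dots> \<le> \<bar>e n\<bar> / d" using r(1) r(2)[of n] by (intro frac_le) auto
      finally show "f j v (u n j) \<le> \<bar>e n\<bar> / d" .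
    qed
    then show ?thesis using ebj.minty[OF C(3) xsC] xsC by (simp add: EP_def)
  qed
  ultimately have "xs \<in> F" by (simp add: F)
  \<comment> \<open>\<open>xs\<close> minimizes over the intersection of all \<open>Cs n\<close>,
    which contains \<open>F\<close>, and it lies in \<open>F\<close>.\<close>
  have "generalized_projection F x0 = xs"
    by (rule generalized_projection_eqI[of "\<Inter>n. Cs n"])
      (use Cs \<open>xs \<in> F\<close> xs_min in \<open>auto intro!: convex_INT\<close>)
  then show ?thesis using xs by simp
qed

end
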